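(* Consider Brochette first-passage percolation on $\mathbb{Z}^d$, $d\ge2$, where passage times take values in $[0,+\infty]$, and let $a$ be the infimum of the support of their distribution. If $\mathbb{P}(\tau<+\infty)>0$, then for every $x\in\mathbb{Z}^d$, $$\lim_{n\to+\infty}\frac{T^{\ast}(0,nx)}{n}=a\lVert x\rVert_1\quad\text{in probability.}$$
   Context: Brochette first-passage percolation (with possibly infinite passage times): let $\mathbb{E}^d$ be the set of edges $\{x,y\}$ with $x,y\in\mathbb{Z}^d$, $\lVert x-y\rVert_1=1$. An integer line is the set of points of $\mathbb{Z}^d$ lying on a common line of $\mathbb{R}^d$ parallel to one of the coordinate axes; $\Delta$ is the set of integer lines. Let $(\tau_\delta)_{\delta\in\Delta}$ be i.i.d. random variables with values in $[0,+\infty]$, with the same distribution as a random variable $\tau$ with cumulative distribution function $F$. The passage time $\tau_e$ of an edge $e$ is $\tau_e=\tau_\delta$, where $\delta$ is the unique integer line containing both endpoints of $e$. The infimum $a\ge 0$ of the support is characterized by $F(a+\eta)>0$ and $F(a-\eta)=0$ for all $\eta>0$. For $x,y\in\mathbb{Z}^d$, $T(x,y)=\inf_\Gamma\sum_{e\in\Gamma}\tau_e$, the infimum being over finite nearest-neighbour paths $\Gamma$ from $x$ to $y$ (so $T(x,x)=0$). Let $\mathcal{C}_\ast$ be the subgraph formed by the edges with finite passage time and their endpoints. For $x\in\mathbb{Z}^d$, $x^\ast$ is the vertex of $\mathcal{C}_\ast$ closest to $x$ in $L^1$ norm, with an arbitrary rule to break ties, and $T^\ast(x,y)=T(x^\ast,y^\ast)$.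 *)

theory Defs
  imports "HOL-Probability.Probability"
begin

definition l1_norm :: "int ^ 'd \<Rightarrow> int" where
  "l1_norm x = (\<Sum>i\<in>UNIV. \<bar>x $ i\<bar>)"

definition adjacent :: "int ^ 'd \<Rightarrow> int ^ 'd \<Rightarrow> bool" where
  "adjacent x y \<longleftrightarrow> l1_norm (x - y) = 1"

definition edges :: "(int ^ 'd) set set" where
  "edges = {{x, y} | x y. adjacent x y}"

definition coordinate_line :: "int ^ 'd \<Rightarrow> 'd \<Rightarrow> (int ^ 'd) set" where
  "coordinate_line x i = range (\<lambda>k. x + axis i k)"

definition integer_lines :: "(int ^ 'd) set set" where
  "integer_lines = {coordinate_line x i | x i. True}"

text \<open>A configuration \<open>t\<close> assigns a passage time to every integer line; its values on
  other sets of points are never used.\<close>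

definition edge_time :: "((int ^ 'd) set \<Rightarrow> ennreal) \<Rightarrow> (int ^ 'd) set \<Rightarrow> ennreal" where
  "edge_time t e = t (THE \<delta>. \<delta> \<in> integer_lines \<and> e \<subseteq> \<delta>)"

definition lattice_path :: "int ^ 'd \<Rightarrow> int ^ 'd \<Rightarrow> (int ^ 'd) list \<Rightarrow> bool" where
  "lattice_path x y p \<longleftrightarrow> p \<noteq> [] \<and> hd p = x \<and> last p = y \<and> successively adjacent p"

definition path_time :: "((int ^ 'd) set \<Rightarrow> ennreal) \<Rightarrow> (int ^ 'd) list \<Rightarrow> ennreal" where
  "path_time t p = (\<Sum>k<length p - 1. edge_time t {p ! k, p ! Suc k})"

definition passage_time ::
  "((int ^ 'd) set \<Rightarrow> ennreal) \<Rightarrow> int ^ 'd \<Rightarrow> int ^ 'd \<Rightarrow> ennreal" where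
  "passage_time t x y = (INF p\<in>{p. lattice_path x y p}. path_time t p)"

definition finite_edges :: "((int ^ 'd) set \<Rightarrow> ennreal) \<Rightarrow> (int ^ 'd) set set" where
  "finite_edges t = {e \<in> edges. edge_time t e < \<infinity>}"

definition finite_vertices :: "((int ^ 'd) set \<Rightarrow> ennreal) \<Rightarrow> (int ^ 'd) set" where
  "finite_vertices t = \<Union> (finite_edges t)"

definition closest_vertices ::
  "((int ^ 'd) set \<Rightarrow> ennreal) \<Rightarrow> int ^ 'd \<Rightarrow> (int ^ 'd) set" where
  "closest_vertices t x =
    {v \<in> finite_vertices t. \<forall>w\<in>finite_vertices t. l1_norm (v - x) \<le> l1_norm (w - x)}"

definition inf_support :: "ennreal measure \<Rightarrow> ennreal" where
  "inf_support \<mu> = Inf {t. \<forall>U. open U \<longrightarrow> t \<in> U \<longrightarrow> 0 < emeasure \<mu> U}"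

text \<open>Random variables may be infinite: since \<open>\<bar>\<infinity> - c\<bar> = \<infinity>\<close> in \<^typ>\<open>ereal\<close>, infinite values
  count as deviations from the limit. Measurability is part of the definition because
  \<^const>\<open>measure\<close> vanishes on non-measurable sets.\<close>

definition tendsto_in_probability ::
  "'w measure \<Rightarrow> (nat \<Rightarrow> 'w \<Rightarrow> ereal) \<Rightarrow> real \<Rightarrow> bool" where
  "tendsto_in_probability M Y c \<longleftrightarrow>
    (\<forall>n. Y n \<in> borel_measurable M) \<and>
    (\<forall>\<epsilon>>0. (\<lambda>n. measure M {\<omega> \<in> space M. ereal \<epsilon> < \<bar>Y n \<omega> - ereal c\<bar>}) \<longlonglongrightarrow> 0)"

lemma coordinate_line_iff: "y \<in> coordinate_line x i \<longleftrightarrow> (\<forall>j. j \<noteq> i \<longrightarrow> y $ j = x $ j)"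
proof
  assume "y \<in> coordinate_line x i"
  then show "\<forall>j. j \<noteq> i \<longrightarrow> y $ j = x $ j"
    by (auto simp: coordinate_line_def axis_def)
next
  assume "\<forall>j. j \<noteq> i \<longrightarrow> y $ j = x $ j"
  then have "y = x + axis i (y $ i - x $ i)"
    by (auto simp: vec_eq_iff axis_def)
  then show "y \<in> coordinate_line x i"
    unfolding coordinate_line_def by blast
qed

lemma edge_in_unique_line:
  fixes e :: "(int ^ 'd) set"
  assumes "e \<in> edges"
  shows "\<exists>!\<delta>. \<delta> \<in> integer_lines \<and> e \<subseteq> \<delta>"
proof -
  obtain x y where e: "e = {x, y}" and adj: "(\<Sum>i\<in>UNIV. \<bar>(x - y) $ i\<bar>) = 1"
    using assms by (auto simp: edges_def adjacent_def l1_norm_def)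
  then obtain i where i: "\<bar>(x - y) $ i\<bar> \<noteq> 0"
    by (metis sum.neutral zero_neq_one)
  have "(\<Sum>j\<in>UNIV. \<bar>(x - y) $ j\<bar>) = \<bar>(x - y) $ i\<bar> + (\<Sum>j\<in>UNIV - {i}. \<bar>(x - y) $ j\<bar>)"
    by (simp add: sum.remove)
  moreover have "(\<Sum>j\<in>UNIV - {i}. \<bar>(x - y) $ j\<bar>) \<ge> 0"
    by (simp add: sum_nonneg)
  ultimately have "(\<Sum>j\<in>UNIV - {i}. \<bar>(x - y) $ j\<bar>) = 0"
    using adj i by linarith
  then have eq: "y $ j = x $ j" if "j \<noteq> i" for j
    using that by (subst (asm) sum_nonneg_eq_0_iff) auto
  show ?thesis
  proof (intro ex1I[of _ "coordinate_line x i"] conjI)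
    show "coordinate_line x i \<in> integer_lines"
      by (auto simp: integer_lines_def)
    show "e \<subseteq> coordinate_line x i"
      using eq by (auto simp: e coordinate_line_iff)
  next
    fix \<delta> assume d: "\<delta> \<in> integer_lines \<and> e \<subseteq> \<delta>"
    then obtain z k where \<delta>: "\<delta> = coordinate_line z k"
      by (auto simp: integer_lines_def)
    have xy: "\<forall>j. j \<noteq> k \<longrightarrow> x $ j = z $ j" "\<forall>j. j \<noteq> k \<longrightarrow> y $ j = z $ j"
      using d by (auto simp: \<delta> e coordinate_line_iff)
    have "k = i"
      using xy i by (metis abs_zero diff_self vector_minus_component)
    then show "\<delta> = coordinate_line x i"
      using xy by (auto simp: \<delta> coordinate_line_iff)
  qed
qed

lemma inf_support_characterization:
  fixes X :: "'v \<Rightarrow> ennreal"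
  assumes N: "prob_space N" and X: "X \<in> borel_measurable N"
    and fin: "0 < measure N {v \<in> space N. X v < \<infinity>}"
  shows "inf_support (distr N borel X) < \<infinity>"
    and "0 < \<eta> \<Longrightarrow>
      0 < measure N {v \<in> space N.
        enn2ereal (X v) \<le> ereal (enn2real (inf_support (distr N borel X)) + \<eta>)}"
    and "0 < \<eta> \<Longrightarrow>
      measure N {v \<in> space N.
        enn2ereal (X v) \<le> ereal (enn2real (inf_support (distr N borel X)) - \<eta>)} = 0"
proof -
  interpret N: prob_space N by (rule N)
  define \<mu> where "\<mu> = distr N borel X"
  define S where "S = {t. \<forall>U. open U \<longrightarrow> t \<in> U \<longrightarrow> 0 < emeasure \<mu> U}"
  have a: "inf_support \<mu> = Inf S"
    by (simp add: inf_support_def S_def)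
  have em: "emeasure \<mu> U = emeasure N {v \<in> space N. X v \<in> U}" if "U \<in> sets borel" for U
    using that X by (simp add: \<mu>_def emeasure_distr vimage_def Int_def conj_commute)
  have null: "emeasure \<mu> A = 0" if "A \<in> sets borel" and disj: "A \<inter> S = {}" for A
  proof -
    define F where "F = {U. open U \<and> emeasure \<mu> U = 0}"
    have F: "\<And>U. U \<in> F \<Longrightarrow> open U"
      by (simp add: F_def)
    obtain F' where F': "F' \<subseteq> F" "countable F'" "\<Union>F' = \<Union>F"
      using Lindelof[OF F] by blast
    have sub: "A \<subseteq> \<Union>F'"
      using disj by (auto simp: F'(3) F_def S_def zero_less_iff_neq_zero)
    have nF: "\<And>U. U \<in> F' \<Longrightarrow> U \<in> null_sets \<mu>"
      using F'(1) by (auto simp: F_def null_sets_def \<mu>_def)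
    then have "(\<Union>U\<in>F'. U) \<in> null_sets \<mu>"
      using F'(2) by (intro null_sets_UN') blast+
    then have nU: "\<Union>F' \<in> null_sets \<mu>"
      by simp
    have "A \<in> sets \<mu>"
      using that(1) by (simp add: \<mu>_def)
    from null_sets_subset[OF nU this sub]
    show ?thesis by (rule null_setsD1)
  qed
  have "\<exists>s\<in>S. s < \<infinity>"
  proof (rule ccontr)
    assume "\<not> (\<exists>s\<in>S. s < \<infinity>)"
    then have "emeasure \<mu> {..<\<infinity>} = 0"
      by (intro null) auto
    then show False
      using fin by (simp add: em N.emeasure_eq_measure)
  qed
  then show lt: "inf_support (distr N borel X) < \<infinity>"
    unfolding \<mu>_def[symmetric] a by (metis Inf_lower order_le_less_trans)
  define r where "r = enn2real (inf_support \<mu>)"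
  have r: "ennreal r = Inf S" "0 \<le> r"
    using lt by (auto simp: r_def a[symmetric] \<mu>_def)
  {
    fix \<eta> :: real assume \<eta>: "0 < \<eta>"
    have "Inf S < ennreal (r + \<eta>)"
      using \<eta> r by (metis ennreal_lessI add_pos_nonneg less_add_same_cancel1 add.commute)
    then obtain s where s: "s \<in> S" "s < ennreal (r + \<eta>)"
      by (auto simp: Inf_less_iff)
    then have "0 < emeasure \<mu> {..<ennreal (r + \<eta>)}"
      by (auto simp: S_def)
    also have "\<dots> = emeasure N {v \<in> space N. X v < ennreal (r + \<eta>)}"
      by (simp add: em)
    also have "\<dots> \<le> emeasure N {v \<in> space N. enn2ereal (X v) \<le> ereal (r + \<eta>)}"
    proof (rule emeasure_mono)
      have "enn2ereal (ennreal (r + \<eta>)) = ereal (r + \<eta>)"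
        using \<eta> r(2) by (simp del: ennreal_plus)
      then show "{v \<in> space N. X v < ennreal (r + \<eta>)}
          \<subseteq> {v \<in> space N. enn2ereal (X v) \<le> ereal (r + \<eta>)}"
        by (auto simp: less_ennreal.rep_eq simp del: ennreal_plus)
    qed (use X in measurable)
    finally show "0 < measure N {v \<in> space N.
        enn2ereal (X v) \<le> ereal (enn2real (inf_support (distr N borel X)) + \<eta>)}"
      by (simp add: N.emeasure_eq_measure \<mu>_def[symmetric] r_def[symmetric])
    have "{v \<in> space N. enn2ereal (X v) \<le> ereal (r - \<eta>)}
        \<subseteq> {v \<in> space N. X v \<in> {..<Inf S}}"
    proof safe
      fix v assume *: "enn2ereal (X v) \<le> ereal (r - \<eta>)"
      also have "\<dots> < ereal r"
        using \<eta> by simp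
      finally show "X v < Inf S"
        unfolding r(1)[symmetric] using r(2) by (simp add: less_ennreal.rep_eq max_def)
    qed
    then have "emeasure N {v \<in> space N. enn2ereal (X v) \<le> ereal (r - \<eta>)}
        \<le> emeasure N {v \<in> space N. X v \<in> {..<Inf S}}"
      using X by (intro emeasure_mono) auto
    also have "\<dots> = emeasure \<mu> {..<Inf S}"
      by (simp add: em)
    also have "\<dots> = 0"
      by (intro null) (auto simp: Inf_lower leD)
    finally show "measure N {v \<in> space N.
        enn2ereal (X v) \<le> ereal (enn2real (inf_support (distr N borel X)) - \<eta>)} = 0"
      by (simp add: N.emeasure_eq_measure \<mu>_def[symmetric] r_def[symmetric])
  }
qed

lemma closest_vertices_nonempty:
  assumes "finite_vertices t \<noteq> {}"
  shows "closest_vertices t x \<noteq> {}"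
proof -
  obtain v where v: "v \<in> finite_vertices t"
    "\<forall>w. w \<in> finite_vertices t \<longrightarrow> nat (l1_norm (v - x)) \<le> nat (l1_norm (w - x))"
    using assms ex_has_least_nat[of "\<lambda>v. v \<in> finite_vertices t" _ "\<lambda>v. nat (l1_norm (v - x))"]
    by blast
  have "0 \<le> l1_norm (z - x)" for z
    by (simp add: l1_norm_def sum_nonneg)
  with v(2) have "\<forall>w\<in>finite_vertices t. l1_norm (v - x) \<le> l1_norm (w - x)"
    by (simp add: nat_le_eq_zle)
  with v(1) show ?thesis
    unfolding closest_vertices_def by blast
qed

lemma finite_closest_vertices: "finite (closest_vertices t x)"
proof (cases "closest_vertices t x = {}")
  case False
  then obtain u where u: "u \<in> closest_vertices t x" by blast
  define R where "R = l1_norm (u - x)"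
  have "closest_vertices t x \<subseteq> vec_lambda ` PiE UNIV (\<lambda>i. {x $ i - R..x $ i + R})"
  proof
    fix v assume v: "v \<in> closest_vertices t x"
    then have le: "l1_norm (v - x) \<le> R"
      using u by (auto simp: closest_vertices_def R_def)
    have "\<bar>v $ i - x $ i\<bar> \<le> R" for i
    proof -
      have "\<bar>(v - x) $ i\<bar> \<le> l1_norm (v - x)"
        unfolding l1_norm_def by (rule member_le_sum) auto
      with le show ?thesis by simp
    qed
    then have "x $ i - R \<le> v $ i \<and> v $ i \<le> x $ i + R" for i
      by (metis abs_diff_le_iff)
    then have "(\<lambda>i. v $ i) \<in> PiE UNIV (\<lambda>i. {x $ i - R..x $ i + R})"
      by auto
    then show "v \<in> vec_lambda ` PiE UNIV (\<lambda>i. {x $ i - R..x $ i + R})"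
      by (metis image_eqI vec_nth_inverse)
  qed
  moreover have "finite (PiE UNIV (\<lambda>i. {x $ i - R..x $ i + R}))"
    by (intro finite_PiE) auto
  ultimately show ?thesis
    by (meson finite_imageI finite_subset)
qed simp

lemma pred_Bex_countable:
  assumes "countable A" and "\<And>i. i \<in> A \<Longrightarrow> Measurable.pred M (P i)"
  shows "Measurable.pred M (\<lambda>\<omega>. \<exists>i\<in>A. P i \<omega>)"
proof -
  have "(\<Union>i\<in>A. {\<omega> \<in> space M. P i \<omega>}) \<in> sets M"
    using assms by (intro sets.countable_UN') (auto simp: pred_def)
  also have "(\<Union>i\<in>A. {\<omega> \<in> space M. P i \<omega>}) = {\<omega> \<in> space M. \<exists>i\<in>A. P i \<omega>}"
    by auto
  finally show ?thesis
    by (simp add: pred_def)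
qed

text \<open>A tie-breaking rule is modelled by a measurable selection from \<^const>\<open>closest_vertices\<close>;
  every deterministic rule yields one.\<close>

lemma measurable_tie_breaking:
  fixes tau :: "(int ^ 'd) set \<Rightarrow> 'w \<Rightarrow> ennreal" and rule :: "(int ^ 'd) set \<Rightarrow> int ^ 'd"
  assumes tau: "\<And>\<delta>. \<delta> \<in> integer_lines \<Longrightarrow> tau \<delta> \<in> borel_measurable M"
  shows "(\<lambda>\<omega>. rule (closest_vertices (\<lambda>\<delta>. tau \<delta> \<omega>) x)) \<in> measurable M (count_space UNIV)"
proof -
  define V where "V = (\<lambda>\<omega>. finite_vertices (\<lambda>\<delta>. tau \<delta> \<omega>))"
  define C where "C = (\<lambda>\<omega>. closest_vertices (\<lambda>\<delta>. tau \<delta> \<omega>) x)"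
  have "(edges :: (int ^ 'd) set set) \<subseteq> (\<lambda>(y, z). {y, z}) ` UNIV"
    by (auto simp: edges_def)
  then have cE: "countable (edges :: (int ^ 'd) set set)"
    by (rule countable_subset) auto
  have e: "(\<lambda>\<omega>. edge_time (\<lambda>\<delta>. tau \<delta> \<omega>) e) \<in> borel_measurable M" if "e \<in> edges" for e
    unfolding edge_time_def
    using theI'[OF edge_in_unique_line[OF that]] by (intro tau) auto
  have V: "Measurable.pred M (\<lambda>\<omega>. v \<in> V \<omega>)" for v
  proof -
    have "(\<lambda>\<omega>. v \<in> V \<omega>) =
        (\<lambda>\<omega>. \<exists>e\<in>{e \<in> edges. v \<in> e}. edge_time (\<lambda>\<delta>. tau \<delta> \<omega>) e < \<infinity>)"
      by (auto simp: V_def finite_vertices_def finite_edges_def)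
    moreover have "Measurable.pred M
        (\<lambda>\<omega>. \<exists>e\<in>{e \<in> edges. v \<in> e}. edge_time (\<lambda>\<delta>. tau \<delta> \<omega>) e < \<infinity>)"
    proof (rule pred_Bex_countable)
      show "countable {e \<in> edges. v \<in> e}"
        using cE by (rule countable_subset[rotated]) auto
      fix e assume "e \<in> {e \<in> edges. v \<in> e}"
      then have [measurable]: "(\<lambda>\<omega>. edge_time (\<lambda>\<delta>. tau \<delta> \<omega>) e) \<in> borel_measurable M"
        using e by auto
      show "Measurable.pred M (\<lambda>\<omega>. edge_time (\<lambda>\<delta>. tau \<delta> \<omega>) e < \<infinity>)"
        by measurable
    qed
    ultimately show ?thesis by simp
  qed
  have C: "Measurable.pred M (\<lambda>\<omega>. v \<in> C \<omega>)" for v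
  proof -
    note V[measurable]
    have "(\<lambda>\<omega>. v \<in> C \<omega>) =
        (\<lambda>\<omega>. v \<in> V \<omega> \<and> (\<forall>w. w \<in> V \<omega> \<longrightarrow> l1_norm (v - x) \<le> l1_norm (w - x)))"
      by (auto simp: C_def closest_vertices_def V_def)
    also have "Measurable.pred M \<dots>"
      by measurable
    finally show ?thesis .
  qed
  have CS: "Measurable.pred M (\<lambda>\<omega>. C \<omega> = S)" for S
  proof -
    note C[measurable]
    have "(\<lambda>\<omega>. C \<omega> = S) = (\<lambda>\<omega>. \<forall>v. v \<in> C \<omega> \<longleftrightarrow> v \<in> S)"
      by auto
    also have "Measurable.pred M \<dots>"
      by measurable
    finally show ?thesis .
  qed
  have "Measurable.pred M (\<lambda>\<omega>. rule (C \<omega>) = y)" for y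
  proof -
    have "(\<lambda>\<omega>. rule (C \<omega>) = y) = (\<lambda>\<omega>. \<exists>S\<in>{S. finite S \<and> rule S = y}. C \<omega> = S)"
      using finite_closest_vertices by (auto simp: C_def)
    moreover have "countable {S :: (int ^ 'd) set. finite S \<and> rule S = y}"
      by (rule countable_subset[OF _ countable_Collect_finite]) auto
    ultimately show ?thesis
      by (simp only:) (rule pred_Bex_countable, simp, rule CS)
  qed
  then have "(\<lambda>\<omega>. rule (C \<omega>)) -` {y} \<inter> space M \<in> sets M" for y
    by (simp add: pred_def vimage_def Int_def conj_commute)
  then have "(\<lambda>\<omega>. rule (C \<omega>)) \<in> measurable M (count_space UNIV)"
    by (subst measurable_count_space_eq2_countable) auto
  then show ?thesis
    by (simp add: C_def)
qed

end

theory Submission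
  imports Defs "HOL-Real_Asymp.Real_Asymp"
begin

text \<open>
  Let \<open>a\<close> be the infimum of the support.

  The lower bound is immediate: almost surely no line is faster than \<open>a\<close>, so every path costs at
  least \<open>a\<close> times the \<open>L\<^sup>1\<close>-distance of its endpoints, and \<open>x\<^sup>*\<close> is within a bounded distance of
  \<open>x\<close> with high probability, because already the parallel lines through a segment of length \<open>R\<close>
  starting at \<open>x\<close> are independent and each is finite with the same positive probability.

  For the upper bound, fix \<open>\<eta> > 0\<close> and call a line fast if its time is at most \<open>a + \<eta>\<close>; lines are
  fast with a probability \<open>p > 0\<close>. Since a whole line shares one passage time, travelling far along
  a fast line costs \<open>a + \<eta>\<close> per step, and in the coordinate direction of the line no distance is
  wasted. It remains to change direction cheaply and to end at the right point. In dimension at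
  least three two fast lines usually do not meet, so the two endpoints are moved simultaneously: if
  \<open>u\<close> and \<open>v\<close> lie on fast lines of direction \<open>i\<close>, then \<open>u\<close> travels until it has the \<open>i\<close>-th
  coordinate of \<open>v\<close>, and then both points are shifted in direction \<open>i\<close> by a common amount \<open>k\<close> such
  that the lines of direction \<open>j\<close> through both shifted points are fast. From now on the \<open>i\<close>-th
  coordinates agree. When all directions have been treated, both points are on the same line and
  are joined along it (\<open>passage_time_between_fast_lines\<close>). The total cost is
  \<open>(a + \<eta>) (\<parallel>u - v\<parallel>\<^sub>1 + O(k))\<close>.

  A suitable shift \<open>k\<close> below \<open>m\<close> fails to exist with probability at most \<open>(1 - p\<^sup>2)\<^sup>m\<close>, as the
  lines involved for different \<open>k\<close> are different. With \<open>m\<close> of order \<open>\<surd>n\<close> this beats the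
  polynomial number of pairs of points in a cube of side \<open>O(n)\<close>, so that with high probability
  shifts of size \<open>o(n)\<close> exist simultaneously for all pairs (\<open>prob_not_well_connected_le\<close>).
  Finally, \<open>0\<^sup>*\<close> and \<open>(n x)\<^sup>*\<close> lie on finite lines near \<open>0\<close> and \<open>n x\<close>. With high probability the
  times of these lines are at most of order \<open>n\<^sup>1\<^sup>/\<^sup>4\<close>, so walking along them to the next fast
  line costs at most \<open>O(n\<^sup>3\<^sup>/\<^sup>4)\<close>.
\<close>

section \<open>Lattice geometry and passage times\<close>

lemma l1_norm_nonneg: "0 \<le> l1_norm x"
  by (simp add: l1_norm_def sum_nonneg)

lemma l1_norm_minus_commute: "l1_norm (x - y) = l1_norm (y - x)"
  by (simp add: l1_norm_def abs_minus_commute)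

lemma l1_norm_triangle: "l1_norm (x - z) \<le> l1_norm (x - y) + l1_norm (y - z)"
  unfolding l1_norm_def sum.distrib[symmetric] by (rule sum_mono) simp

lemma l1_norm_axis: "l1_norm (axis i k) = \<bar>k\<bar>"
proof -
  have "\<bar>axis i k $ j\<bar> = (if j = i then \<bar>k\<bar> else 0)" for j
    by (simp add: axis_def)
  then show ?thesis
    by (simp add: l1_norm_def)
qed

lemma abs_component_le_l1_norm: "\<bar>x $ i\<bar> \<le> l1_norm x"
  unfolding l1_norm_def by (rule member_le_sum) auto

lemma l1_norm_scale: "l1_norm (k *s x) = \<bar>k\<bar> * l1_norm x"
  by (simp add: l1_norm_def abs_mult sum_distrib_left)

lemma edge_time_eq:
  assumes "adjacent x y" "\<And>l. l \<noteq> i \<Longrightarrow> y $ l = x $ l"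
  shows "edge_time t {x, y} = t (coordinate_line x i)"
proof -
  have e: "{x, y} \<in> edges"
    using assms(1) by (auto simp: edges_def)
  have "coordinate_line x i \<in> integer_lines \<and> {x, y} \<subseteq> coordinate_line x i"
    using assms(2) by (auto simp: integer_lines_def coordinate_line_iff)
  then show ?thesis
    unfolding edge_time_def by (simp only: the1_equality[OF edge_in_unique_line[OF e]])
qed

lemma edge_time_ge:
  assumes "\<And>\<delta>. \<delta> \<in> integer_lines \<Longrightarrow> b \<le> t \<delta>" "adjacent x y"
  shows "b \<le> edge_time t {x, y}"
proof -
  have "{x, y} \<in> edges"
    using assms(2) by (auto simp: edges_def)
  from theI'[OF edge_in_unique_line[OF this]] show ?thesis
    unfolding edge_time_def using assms(1) by blast
qed

lemma path_time_singleton: "path_time t [x] = 0"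
  by (simp add: path_time_def)

lemma path_time_Cons: "path_time t (x # y # p) = edge_time t {x, y} + path_time t (y # p)"
proof -
  have "length (x # y # p) - 1 = Suc (length (y # p) - 1)"
    by simp
  then show ?thesis
    unfolding path_time_def by (simp only: sum.lessThan_Suc_shift nth_Cons_0 nth_Cons_Suc)
qed

lemma path_time_append: "path_time t (p @ y # q) = path_time t (p @ [y]) + path_time t (y # q)"
proof (induction p)
  case (Cons a p)
  then show ?case
    by (cases p) (simp_all add: path_time_Cons path_time_singleton add.assoc)
qed (simp add: path_time_singleton)

lemma passage_time_le: "lattice_path x y p \<Longrightarrow> passage_time t x y \<le> path_time t p"
  unfolding passage_time_def by (rule INF_lower) simp

lemma passage_time_self: "passage_time t x x = 0"
  using passage_time_le[of x x "[x]" t] by (simp add: lattice_path_def path_time_singleton)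

lemma passage_time_edge: "adjacent x y \<Longrightarrow> passage_time t x y \<le> edge_time t {x, y}"
  using passage_time_le[of x y "[x, y]" t]
  by (simp add: lattice_path_def path_time_singleton path_time_Cons)

lemma ennreal_INF_add_left:
  fixes f :: "'i \<Rightarrow> ennreal"
  assumes "I \<noteq> {}"
  shows "(INF i\<in>I. c + f i) = c + (INF i\<in>I. f i)"
  using continuous_at_Inf_mono[of "\<lambda>x. c + x" "f ` I"] assms
  using continuous_add[of "at_right (Inf (f ` I))", of "\<lambda>x. c" "\<lambda>x. x"]
  by (auto simp: mono_def image_comp)

lemma passage_time_triangle: "passage_time t x z \<le> passage_time t x y + passage_time t y z"
proof -
  have join: "passage_time t x z \<le> path_time t p + path_time t q"
    if p: "lattice_path x y p" and q: "lattice_path y z q" for p q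
  proof -
    obtain p' where p': "p = p' @ [y]"
      using p by (metis append_butlast_last_id lattice_path_def)
    obtain q' where q': "q = y # q'"
      using q by (metis list.collapse lattice_path_def)
    have "successively adjacent (p' @ y # q')"
      using p q unfolding lattice_path_def p' q' successively_append_iff by simp
    moreover have "hd (p' @ y # q') = x" "last (p' @ y # q') = z"
      using p q unfolding lattice_path_def p' q' by (auto simp: hd_append)
    ultimately have "lattice_path x z (p' @ y # q')"
      by (simp add: lattice_path_def)
    from passage_time_le[OF this, of t] show ?thesis
      unfolding p' q' path_time_append[of t p' y q'] .
  qed
  have *: "passage_time t x z \<le> path_time t p + passage_time t y z" if "lattice_path x y p" for p
  proof (cases "\<exists>q. lattice_path y z q")
    case True
    then have ne: "{q. lattice_path y z q} \<noteq> {}"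
      by auto
    show ?thesis
      unfolding passage_time_def[of t y z] ennreal_INF_add_left[OF ne, symmetric]
      using join[OF that] by (intro INF_greatest) simp
  qed (simp add: passage_time_def[of t y z])
  show ?thesis
  proof (cases "\<exists>p. lattice_path x y p")
    case True
    then have ne: "{p. lattice_path x y p} \<noteq> {}"
      by auto
    show ?thesis
      unfolding passage_time_def[of t x y] add.commute[of "Inf _"]
        ennreal_INF_add_left[OF ne, symmetric]
      using * by (intro INF_greatest) (simp add: add.commute)
  qed (simp add: passage_time_def[of t x y])
qed

lemma coordinate_line_cong:
  assumes "\<And>l. l \<noteq> i \<Longrightarrow> y $ l = x $ l"
  shows "coordinate_line y i = coordinate_line x i"
  using assms by (auto simp: coordinate_line_iff)

lemma passage_time_along_line:
  assumes "\<And>l. l \<noteq> i \<Longrightarrow> y $ l = x $ l" and "t (coordinate_line x i) \<le> c"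
  shows "passage_time t x y \<le> c * of_nat (nat \<bar>y $ i - x $ i\<bar>)"
  using assms
proof (induction "nat \<bar>y $ i - x $ i\<bar>" arbitrary: x)
  case 0
  then have "y $ l = x $ l" for l
    by (cases "l = i") auto
  then have "x = y"
    by (simp add: vec_eq_iff)
  then show ?case
    by (simp add: passage_time_self)
next
  case (Suc n)
  define s where "s = sgn (y $ i - x $ i)"
  define x' where "x' = x + axis i s"
  have s: "\<bar>s\<bar> = 1"
    using Suc.hyps(2) by (auto simp: s_def)
  have "l1_norm (x - x') = l1_norm (x' - x)"
    by (rule l1_norm_minus_commute)
  then have adj: "adjacent x x'"
    using s by (simp add: adjacent_def x'_def l1_norm_axis)
  have x': "x' $ l = x $ l" if "l \<noteq> i" for l
    using that by (simp add: x'_def axis_def)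
  have n: "n = nat \<bar>y $ i - x' $ i\<bar>"
    using Suc.hyps(2) by (auto simp: x'_def s_def sgn_if split: if_splits)
  have "passage_time t x x' \<le> c"
    using passage_time_edge[OF adj, of t] edge_time_eq[OF adj x', of i t] Suc.prems(2) by simp
  moreover have "passage_time t x' y \<le> c * of_nat (nat \<bar>y $ i - x' $ i\<bar>)"
    using Suc.prems x' by (intro Suc.hyps(1) n) (auto simp: coordinate_line_cong[OF x'])
  ultimately have "passage_time t x y \<le> c + c * of_nat n"
    unfolding n[symmetric]
    by (meson add_mono order_trans passage_time_triangle)
  also have "\<dots> = c * of_nat (Suc n)"
    by (simp add: distrib_left)
  finally show ?case
    using Suc.hyps(2) by simp
qed

text \<open>Every edge costs at least \<open>b\<close> and moves by one unit in \<open>L\<^sup>1\<close>-norm.\<close>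

lemma path_time_lower_bound:
  assumes b: "\<And>\<delta>. \<delta> \<in> integer_lines \<Longrightarrow> b \<le> t \<delta>"
    and "p \<noteq> []" "successively adjacent p"
  shows "b * of_nat (nat (l1_norm (hd p - last p))) \<le> path_time t p"
  using assms(2,3)
proof (induction p rule: induct_list012)
  case (2 v)
  then show ?case
    by (simp add: l1_norm_def)
next
  case (3 v w p)
  define z where "z = last (w # p)"
  have adj: "adjacent v w"
    using "3.prems" by simp
  have IH: "b * of_nat (nat (l1_norm (w - z))) \<le> path_time t (w # p)"
    using 3 by (simp add: z_def)
  have "nat (l1_norm (v - z)) \<le> 1 + nat (l1_norm (w - z))"
    using l1_norm_triangle[of v z w] adj by (simp add: adjacent_def)
  then have "(of_nat (nat (l1_norm (v - z))) :: ennreal) \<le> of_nat (1 + nat (l1_norm (w - z)))"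
    by (rule of_nat_mono)
  then have "b * of_nat (nat (l1_norm (v - z))) \<le> b * of_nat (1 + nat (l1_norm (w - z)))"
    by (rule mult_left_mono) simp
  also have "\<dots> = b + b * of_nat (nat (l1_norm (w - z)))"
    by (simp add: distrib_left)
  also have "\<dots> \<le> edge_time t {v, w} + path_time t (w # p)"
    by (intro add_mono edge_time_ge[OF b adj] IH)
  also have "\<dots> = path_time t (v # w # p)"
    by (rule path_time_Cons[symmetric])
  finally show ?case
    by (simp only: z_def list.sel last.simps list.distinct if_False)
qed simp

lemma passage_time_lower_bound:
  assumes "\<And>\<delta>. \<delta> \<in> integer_lines \<Longrightarrow> b \<le> t \<delta>"
  shows "b * of_nat (nat (l1_norm (x - y))) \<le> passage_time t x y"
  unfolding passage_time_def
proof (rule INF_greatest)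
  fix p assume "p \<in> {p. lattice_path x y p}"
  then have p: "p \<noteq> []" "successively adjacent p" "hd p = x" "last p = y"
    by (auto simp: lattice_path_def)
  show "b * of_nat (nat (l1_norm (x - y))) \<le> path_time t p"
    using path_time_lower_bound[OF assms p(1,2)] unfolding p(3,4) .
qed

section \<open>Travelling along fast lines\<close>

definition cube :: "int \<Rightarrow> (int ^ 'd) set" where
  "cube r = {z. \<forall>i. \<bar>z $ i\<bar> \<le> r}"

text \<open>The property of a configuration that makes fast travel possible: two points with equal \<open>i\<close>-th
  coordinates can turn together from direction \<open>i\<close> to direction \<open>j\<close>. The shift is common to both points so that
  their \<open>i\<close>-th coordinates remain equal. The case \<open>z = w\<close> says that a single point can turn.\<close>

definition well_connected ::
  "((int ^ 'd) set \<Rightarrow> ennreal) \<Rightarrow> ennreal \<Rightarrow> nat \<Rightarrow> (int ^ 'd) set \<Rightarrow> bool" where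
  "well_connected t c m A \<longleftrightarrow>
    (\<forall>z\<in>A. \<forall>w\<in>A. \<forall>i j. i \<noteq> j \<longrightarrow> z $ i = w $ i \<longrightarrow>
      (\<exists>k<m. t (coordinate_line (z + axis i (int k)) j) \<le> c \<and>
             t (coordinate_line (w + axis i (int k)) j) \<le> c))"

lemma well_connectedE:
  assumes "well_connected t c m A" "z \<in> A" "w \<in> A" "i \<noteq> j" "z $ i = w $ i"
  obtains k where "k < m" "t (coordinate_line (z + axis i (int k)) j) \<le> c"
    "t (coordinate_line (w + axis i (int k)) j) \<le> c"
  using assms unfolding well_connected_def by blast

lemma passage_time_axis_shift:
  assumes "t (coordinate_line x i) \<le> c"
  shows "passage_time t x (x + axis i k) \<le> c * of_nat (nat \<bar>k\<bar>)"
    and "passage_time t (x + axis i k) x \<le> c * of_nat (nat \<bar>k\<bar>)"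
proof -
  have *: "(x + axis i k) $ l = x $ l" if "l \<noteq> i" for l
    using that by (simp add: axis_def)
  show "passage_time t x (x + axis i k) \<le> c * of_nat (nat \<bar>k\<bar>)"
    using passage_time_along_line[OF *, of i t c] assms by simp
  show "passage_time t (x + axis i k) x \<le> c * of_nat (nat \<bar>k\<bar>)"
    using passage_time_along_line[OF *[symmetric], of i t c] assms coordinate_line_cong[OF *]
    by simp
qed

text \<open>The coordinates are equalised one after the other; \<open>S\<close> is the set of coordinates in which \<open>u\<close> and
  \<open>v\<close> may still differ, and both points are on fast lines of a direction \<open>i \<in> S\<close>. One step moves
  \<open>u\<close> until its \<open>i\<close>-th coordinate is that of \<open>v\<close> and then shifts both points along \<open>i\<close>, which costs
  at most \<open>2 m\<close> steps in addition to the unavoidable ones and puts them on fast lines of another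
  direction of \<open>S\<close>. Coordinates that have not been treated never change, so the unavoidable steps sum
  up to the distance of the original points. If \<open>S = {i}\<close>, the two lines coincide. The coordinates
  in \<open>S\<close> keep the distance \<open>m\<close> from the boundary of the cube because each of them is shifted once.\<close>

lemma passage_time_between_fast_lines:
  fixes u v :: "int ^ 'd"
  assumes wc: "well_connected t c m (cube r)" and "finite S" "i \<in> S"
    and "t (coordinate_line u i) \<le> c" "t (coordinate_line v i) \<le> c"
    and "\<And>l. l \<notin> S \<Longrightarrow> u $ l = v $ l"
    and "\<And>l. l \<in> S \<Longrightarrow> \<bar>u $ l\<bar> \<le> r - int m \<and> \<bar>v $ l\<bar> \<le> r - int m"
    and "u \<in> cube r" "v \<in> cube r"
  shows "passage_time t u v \<le> c * of_nat ((\<Sum>l\<in>S. nat \<bar>u $ l - v $ l\<bar>) + 2 * m * card S)"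
  using assms(2-)
proof (induction "card S" arbitrary: S i u v)
  case 0
  then show ?case by simp
next
  case (Suc n)
  define S' where "S' = S - {i}"
  have S: "S = insert i S'" "i \<notin> S'" "finite S'" "card S' = n"
    using Suc.hyps(2) Suc.prems(1,2) by (auto simp: S'_def)
  show ?case
  proof (cases "S' = {}")
    case True
    have "passage_time t u v \<le> c * of_nat (nat \<bar>v $ i - u $ i\<bar>)"
      using Suc.prems(3,5) S True by (intro passage_time_along_line) auto
    also have "\<dots> \<le> c * of_nat ((\<Sum>l\<in>S. nat \<bar>u $ l - v $ l\<bar>) + 2 * m * card S)"
      using S True by (intro mult_left_mono of_nat_mono) (auto simp: abs_minus_commute)
    finally show ?thesis .
  next
    case False
    then obtain j where j: "j \<in> S'" by blast
    then have ij: "i \<noteq> j" using S by auto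
    \<comment> \<open>\<open>u'\<close> is level with \<open>v\<close> in direction \<open>i\<close>; \<open>u1\<close> and \<open>v1\<close> are the commonly shifted points.\<close>
    define u' where "u' = u + axis i (v $ i - u $ i)"
    have u': "u' $ i = v $ i" "\<And>l. l \<noteq> i \<Longrightarrow> u' $ l = u $ l"
      by (auto simp: u'_def axis_def)
    have "u' \<in> cube r"
    proof -
      have "\<bar>u' $ l\<bar> \<le> r" for l
        using Suc.prems(7,8) u' by (cases "l = i") (auto simp: cube_def)
      then show ?thesis
        by (simp add: cube_def)
    qed
    from well_connectedE[OF wc this Suc.prems(8) ij u'(1)]
    obtain k where k: "k < m" "t (coordinate_line (u' + axis i (int k)) j) \<le> c"
      "t (coordinate_line (v + axis i (int k)) j) \<le> c" by blast
    define u1 where "u1 = u' + axis i (int k)"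
    define v1 where "v1 = v + axis i (int k)"
    have c1: "u1 $ i = v1 $ i" "v1 $ i = v $ i + int k"
      "\<And>l. l \<noteq> i \<Longrightarrow> u1 $ l = u $ l" "\<And>l. l \<noteq> i \<Longrightarrow> v1 $ l = v $ l"
      using u' by (auto simp: u1_def v1_def axis_def)
    have vi: "\<bar>v1 $ i\<bar> \<le> r"
      using Suc.prems(6)[of i] k(1) S c1(2) by auto
    have cube1: "u1 \<in> cube r" "v1 \<in> cube r"
      using Suc.prems(7,8) c1 vi unfolding cube_def mem_Collect_eq by metis+
    have "u1 = u + axis i (v $ i - u $ i + int k)"
      by (auto simp: u1_def u'_def axis_def vec_eq_iff)
    then have "passage_time t u u1 \<le> c * of_nat (nat \<bar>v $ i - u $ i + int k\<bar>)"
      using passage_time_axis_shift(1)[of t u i c "v $ i - u $ i + int k", OF Suc.prems(3)] by simp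
    also have "\<dots> \<le> c * of_nat (nat \<bar>u $ i - v $ i\<bar> + m)"
      using k(1) by (intro mult_left_mono of_nat_mono) auto
    finally have 1: "passage_time t u u1 \<le> c * of_nat (nat \<bar>u $ i - v $ i\<bar> + m)" .
    have "passage_time t v1 v \<le> c * of_nat (nat \<bar>int k\<bar>)"
      unfolding v1_def using Suc.prems(4) by (rule passage_time_axis_shift(2))
    also have "\<dots> \<le> c * of_nat m"
      using k(1) by (intro mult_left_mono of_nat_mono) auto
    finally have 3: "passage_time t v1 v \<le> c * of_nat m" .
    have "passage_time t u1 v1
        \<le> c * of_nat ((\<Sum>l\<in>S'. nat \<bar>u1 $ l - v1 $ l\<bar>) + 2 * m * card S')"
    proof (rule Suc.hyps(1))
      show "t (coordinate_line u1 j) \<le> c" "t (coordinate_line v1 j) \<le> c"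
        using k by (auto simp: u1_def v1_def)
      show "u1 $ l = v1 $ l" if "l \<notin> S'" for l
        using c1 Suc.prems(5)[of l] that S by (cases "l = i") auto
      show "\<bar>u1 $ l\<bar> \<le> r - int m \<and> \<bar>v1 $ l\<bar> \<le> r - int m" if "l \<in> S'" for l
      proof -
        have "l \<noteq> i" "l \<in> S" using that S by auto
        then show ?thesis using Suc.prems(6)[of l] c1 by auto
      qed
    qed (use S j cube1 in auto)
    moreover have "(\<Sum>l\<in>S'. nat \<bar>u1 $ l - v1 $ l\<bar>) = (\<Sum>l\<in>S'. nat \<bar>u $ l - v $ l\<bar>)"
      using c1(3,4) S(2) by (intro sum.cong refl) metis
    ultimately have 2: "passage_time t u1 v1
        \<le> c * of_nat ((\<Sum>l\<in>S'. nat \<bar>u $ l - v $ l\<bar>) + 2 * m * card S')"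
      by simp
    have "passage_time t u v \<le> passage_time t u u1 + (passage_time t u1 v1 + passage_time t v1 v)"
      by (meson add_left_mono order_trans passage_time_triangle)
    also have "\<dots> \<le> c * of_nat (nat \<bar>u $ i - v $ i\<bar> + m)
        + (c * of_nat ((\<Sum>l\<in>S'. nat \<bar>u $ l - v $ l\<bar>) + 2 * m * card S') + c * of_nat m)"
      by (intro add_mono 1 2 3)
    also have "\<dots> = c * of_nat ((\<Sum>l\<in>S. nat \<bar>u $ l - v $ l\<bar>) + 2 * m * card S)"
    proof -
      have "(\<Sum>l\<in>S. nat \<bar>u $ l - v $ l\<bar>) + 2 * m * card S = (nat \<bar>u $ i - v $ i\<bar> + m)
        + (((\<Sum>l\<in>S'. nat \<bar>u $ l - v $ l\<bar>) + 2 * m * card S') + m)"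
        using S by simp
      then show ?thesis
        unfolding distrib_left[symmetric] of_nat_add[symmetric] by simp
    qed
    finally show ?thesis .
  qed
qed

lemma component_le_l1_norm_diff: "\<bar>x $ l\<bar> \<le> \<bar>y $ l\<bar> + l1_norm (x - y)"
  using abs_component_le_l1_norm[of "x - y" l] by simp

lemma switch_direction:
  assumes wc: "well_connected t c m (cube r)" and z: "z \<in> cube r" and ij: "i \<noteq> j"
    and K: "t (coordinate_line z i) \<le> K"
  obtains z' where "t (coordinate_line z' j) \<le> c" "l1_norm (z' - z) \<le> int m"
    "passage_time t z z' \<le> K * of_nat m" "passage_time t z' z \<le> K * of_nat m"
proof -
  obtain k where k: "k < m" "t (coordinate_line (z + axis i (int k)) j) \<le> c"
    using well_connectedE[OF wc z z ij refl] by blast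
  have le: "K * of_nat (nat \<bar>int k\<bar>) \<le> K * of_nat m"
    using k(1) by (intro mult_left_mono of_nat_mono) auto
  show thesis
  proof (rule that)
    show "l1_norm (z + axis i (int k) - z) \<le> int m"
      using k(1) by (simp add: l1_norm_axis)
  qed (use k(2) passage_time_axis_shift[of t z i K "int k", OF K] le in \<open>auto intro: order_trans\<close>)
qed

lemma obtain_other_direction:
  assumes "2 \<le> CARD('d)"
  obtains i' :: "'d :: finite" where "i' \<noteq> i"
proof -
  have "\<not> UNIV \<subseteq> {i}"
    using assms card_mono[of "{i}" "UNIV :: 'd set"] by auto
  then show thesis
    using that by blast
qed

text \<open>If the target direction \<open>j\<close> is the direction of the current line, one change of direction does not
  suffice: a line of another direction, which exists in dimension at least two, serves as an
  intermediate step. This is why two windows are needed.\<close>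

lemma reach_fast_line:
  fixes z :: "int ^ 'd"
  assumes dim: "2 \<le> CARD('d)" and wc: "well_connected t c m (cube r)"
    and z: "\<And>l. \<bar>z $ l\<bar> \<le> r - int m"
    and K: "t (coordinate_line z i) \<le> K" and cK: "c \<le> K"
  obtains z' where "t (coordinate_line z' j) \<le> c" "l1_norm (z' - z) \<le> 2 * int m"
    "passage_time t z z' \<le> K * of_nat (2 * m)" "passage_time t z' z \<le> K * of_nat (2 * m)"
proof -
  have zc: "z \<in> cube r"
    using z unfolding cube_def by (smt (verit) mem_Collect_eq of_nat_0_le_iff)
  show thesis
  proof (cases "i = j")
    case False
    from switch_direction[where t=t, OF wc zc this K] obtain z' where
      z': "t (coordinate_line z' j) \<le> c" "l1_norm (z' - z) \<le> int m"
      "passage_time t z z' \<le> K * of_nat m" "passage_time t z' z \<le> K * of_nat m" .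
    have "K * of_nat m \<le> K * of_nat (2 * m)"
      by (intro mult_left_mono of_nat_mono) auto
    then show thesis
      using z' by (intro that[of z']) (auto intro: order_trans)
  next
    case True
    obtain i' where i': "i' \<noteq> i"
      by (rule obtain_other_direction[OF dim])
    from switch_direction[where t=t, OF wc zc i'[symmetric] K] obtain z1 where
      z1: "t (coordinate_line z1 i') \<le> c" "l1_norm (z1 - z) \<le> int m"
      "passage_time t z z1 \<le> K * of_nat m" "passage_time t z1 z \<le> K * of_nat m" .
    have "\<bar>z1 $ l\<bar> \<le> r" for l
      using component_le_l1_norm_diff[of z1 l z] z[of l] z1(2) by simp
    then have "z1 \<in> cube r"
      by (simp add: cube_def)
    from switch_direction[where t=t, OF wc this _ order_trans[OF z1(1) cK], of j] obtain z' where
      z': "t (coordinate_line z' j) \<le> c" "l1_norm (z' - z1) \<le> int m"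
      "passage_time t z1 z' \<le> K * of_nat m" "passage_time t z' z1 \<le> K * of_nat m"
      using i' True by blast
    have K2: "K * of_nat (2 * m) = K * of_nat m + K * of_nat m"
      by (simp add: mult_2 distrib_left)
    show thesis
    proof (rule that)
      show "l1_norm (z' - z) \<le> 2 * int m"
        using l1_norm_triangle[of z' z z1] z1(2) z'(2) by simp
      show "passage_time t z z' \<le> K * of_nat (2 * m)"
        unfolding K2 using z1(3) z'(3) by (meson add_mono order_trans passage_time_triangle)
      show "passage_time t z' z \<le> K * of_nat (2 * m)"
        unfolding K2 using z1(4) z'(4) by (meson add_mono order_trans passage_time_triangle)
    qed (rule z'(1))
  qed
qed

text \<open>Only the first and the last \<open>2 m\<close> steps use lines with time up to \<open>K\<close>, which may be much larger
  than \<open>c\<close>. The margin \<open>3 m\<close> to the boundary of the cube pays for these \<open>2 m\<close> steps and for one more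
  shift by less than \<open>m\<close> in each coordinate.\<close>

lemma passage_time_upper_bound:
  fixes u v :: "int ^ 'd"
  assumes dim: "2 \<le> CARD('d)" and wc: "well_connected t c m (cube r)" and cK: "c \<le> K"
    and u: "\<And>l. \<bar>u $ l\<bar> \<le> r - 3 * int m" "t (coordinate_line u i) \<le> K"
    and v: "\<And>l. \<bar>v $ l\<bar> \<le> r - 3 * int m" "t (coordinate_line v j) \<le> K"
  shows "passage_time t u v
    \<le> K * of_nat (4 * m) + c * of_nat (nat (l1_norm (u - v)) + 4 * m + 2 * m * CARD('d))"
proof -
  have small: "\<bar>u $ l\<bar> \<le> r - int m" "\<bar>v $ l\<bar> \<le> r - int m" for l
    using u(1)[of l] v(1)[of l] by auto
  from reach_fast_line[OF dim wc small(1) u(2) cK, of i] obtain u' where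
    u': "t (coordinate_line u' i) \<le> c" "l1_norm (u' - u) \<le> 2 * int m"
      "passage_time t u u' \<le> K * of_nat (2 * m)" by blast
  from reach_fast_line[OF dim wc small(2) v(2) cK, of i] obtain v' where
    v': "t (coordinate_line v' i) \<le> c" "l1_norm (v' - v) \<le> 2 * int m"
      "passage_time t v' v \<le> K * of_nat (2 * m)" by blast
  have small': "\<bar>u' $ l\<bar> \<le> r - int m" "\<bar>v' $ l\<bar> \<le> r - int m" for l
    using component_le_l1_norm_diff[of u' l u] component_le_l1_norm_diff[of v' l v]
      u(1)[of l] v(1)[of l] u'(2) v'(2) by auto
  have "\<bar>u' $ l\<bar> \<le> r \<and> \<bar>v' $ l\<bar> \<le> r" for l
    using small'[of l] by auto
  then have cube: "u' \<in> cube r" "v' \<in> cube r"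
    by (auto simp: cube_def)
  have "passage_time t u' v'
      \<le> c * of_nat ((\<Sum>l\<in>UNIV. nat \<bar>u' $ l - v' $ l\<bar>) + 2 * m * CARD('d))"
    using small' by (intro passage_time_between_fast_lines[OF wc _ _ u'(1) v'(1) _ _ cube]) auto
  also have "(\<Sum>l\<in>UNIV. nat \<bar>u' $ l - v' $ l\<bar>) = nat (l1_norm (u' - v'))"
  proof -
    have "int (\<Sum>l\<in>UNIV. nat \<bar>u' $ l - v' $ l\<bar>) = l1_norm (u' - v')"
      by (simp add: l1_norm_def)
    then show ?thesis
      by linarith
  qed
  also have "c * of_nat (nat (l1_norm (u' - v')) + 2 * m * CARD('d))
      \<le> c * of_nat (nat (l1_norm (u - v)) + 4 * m + 2 * m * CARD('d))"
  proof -
    have "l1_norm (u' - v') \<le> l1_norm (u - v) + 4 * int m"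
      using l1_norm_triangle[of u' v' u] l1_norm_triangle[of u v' v] u'(2) v'(2)
        l1_norm_minus_commute[of v v'] by simp
    then show ?thesis
      using l1_norm_nonneg[of "u - v"] by (intro mult_left_mono of_nat_mono) auto
  qed
  finally have mid: "passage_time t u' v'
      \<le> c * of_nat (nat (l1_norm (u - v)) + 4 * m + 2 * m * CARD('d))" .
  have "passage_time t u v \<le> passage_time t u u' + (passage_time t u' v' + passage_time t v' v)"
    by (meson add_left_mono order_trans passage_time_triangle)
  also have "\<dots> \<le> K * of_nat (2 * m)
      + (c * of_nat (nat (l1_norm (u - v)) + 4 * m + 2 * m * CARD('d)) + K * of_nat (2 * m))"
    by (intro add_mono u'(3) v'(3) mid)
  also have "\<dots> = (K * of_nat (2 * m) + K * of_nat (2 * m))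
      + c * of_nat (nat (l1_norm (u - v)) + 4 * m + 2 * m * CARD('d))"
    by (simp only: ac_simps)
  also have "K * of_nat (2 * m) + K * of_nat (2 * m) = K * of_nat (4 * m)"
    unfolding distrib_left[symmetric] of_nat_add[symmetric] by simp
  finally show ?thesis .
qed

section \<open>Closest vertices on finite lines\<close>

lemma finite_vertices_iff: "v \<in> finite_vertices t \<longleftrightarrow> (\<exists>i. t (coordinate_line v i) < \<infinity>)"
proof
  assume "v \<in> finite_vertices t"
  then obtain e where e: "e \<in> edges" "edge_time t e < \<infinity>" "v \<in> e"
    by (auto simp: finite_vertices_def finite_edges_def)
  from theI'[OF edge_in_unique_line[OF e(1)]] obtain z i where
    zi: "(THE \<delta>. \<delta> \<in> integer_lines \<and> e \<subseteq> \<delta>) = coordinate_line z i" "e \<subseteq> coordinate_line z i"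
    by (auto simp: integer_lines_def)
  have "coordinate_line v i = coordinate_line z i"
    using zi(2) e(3) by (intro coordinate_line_cong) (auto simp: coordinate_line_iff)
  then show "\<exists>i. t (coordinate_line v i) < \<infinity>"
    using e(2) unfolding edge_time_def zi(1) by (metis infinity_ennreal_def)
next
  assume "\<exists>i. t (coordinate_line v i) < \<infinity>"
  then obtain i where i: "t (coordinate_line v i) < \<infinity>" by blast
  define w where "w = v + axis i 1"
  have adj: "adjacent v w"
    using l1_norm_minus_commute[of v w] by (simp add: adjacent_def w_def l1_norm_axis)
  have "edge_time t {v, w} = t (coordinate_line v i)"
    by (rule edge_time_eq[OF adj]) (simp add: w_def axis_def)
  then have "{v, w} \<in> finite_edges t"
    using i adj by (auto simp: finite_edges_def edges_def)
  then show "v \<in> finite_vertices t"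
    unfolding finite_vertices_def by blast
qed

text \<open>A finite line through a point at distance \<open>k\<close> from \<open>y\<close> makes that point a competitor of the
  closest vertex \<open>s\<close>.\<close>

lemma closest_vertex_near:
  assumes s: "finite_vertices t \<noteq> {} \<Longrightarrow> s \<in> closest_vertices t y"
    and k: "k < R" "t (coordinate_line (y + axis i (int k)) j) < \<infinity>"
  shows "l1_norm (s - y) \<le> int R" "\<exists>i. t (coordinate_line s i) < \<infinity>"
proof -
  have f: "y + axis i (int k) \<in> finite_vertices t"
    using k(2) by (auto simp: finite_vertices_iff)
  then have sc: "s \<in> closest_vertices t y"
    using s by blast
  then show "\<exists>i. t (coordinate_line s i) < \<infinity>"
    by (auto simp: closest_vertices_def finite_vertices_iff)
  have "l1_norm (s - y) \<le> l1_norm (y + axis i (int k) - y)"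
    using sc f by (auto simp: closest_vertices_def)
  then show "l1_norm (s - y) \<le> int R"
    using k(1) by (simp add: l1_norm_axis)
qed

text \<open>Parallel lines through points with different coordinates in another direction are different, hence
  independent.\<close>

lemma coordinate_line_eqD:
  assumes "coordinate_line x j = coordinate_line y j" "i \<noteq> j"
  shows "x $ i = y $ i"
proof -
  have "x \<in> coordinate_line x j"
    by (simp add: coordinate_line_iff)
  then show ?thesis
    using assms by (simp add: coordinate_line_iff)
qed

lemma coordinate_line_in_integer_lines: "coordinate_line x i \<in> integer_lines"
  by (auto simp: integer_lines_def)

lemma finite_cube: "finite (cube r :: (int ^ 'd) set)"
  and card_cube_le: "card (cube r :: (int ^ 'd) set) \<le> nat (2 * r + 1) ^ CARD('d)"
proof -
  let ?P = "PiE UNIV (\<lambda>_::'d. {-r..r})"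
  have sub: "cube r \<subseteq> vec_lambda ` ?P"
  proof
    fix z :: "int ^ 'd" assume "z \<in> cube r"
    then have "(\<lambda>i. z $ i) \<in> ?P"
      by (auto simp: cube_def abs_le_iff minus_le_iff)
    then show "z \<in> vec_lambda ` ?P"
      by (metis image_eqI vec_nth_inverse)
  qed
  have fin: "finite ?P"
    by (intro finite_PiE) auto
  show "finite (cube r :: (int ^ 'd) set)"
    using sub fin by (meson finite_imageI finite_subset)
  have "card (cube r :: (int ^ 'd) set) \<le> card (vec_lambda ` ?P)"
    using fin sub by (intro card_mono) auto
  also have "\<dots> \<le> card ?P"
    using fin by (rule card_image_le)
  also have "\<dots> = nat (2 * r + 1) ^ CARD('d)"
    by (simp add: card_PiE)
  finally show "card (cube r :: (int ^ 'd) set) \<le> nat (2 * r + 1) ^ CARD('d)" .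
qed

section \<open>Probabilities of exceptional events\<close>

text \<open>Disjoint blocks of independent variables are independent of each other, and a block of at most
  \<open>k\<close> variables has all its values in \<open>A\<close> with probability at least \<open>p\<^sup>k\<close>.\<close>

lemma (in prob_space) prob_no_block_succeeds_le:
  fixes K :: "nat \<Rightarrow> 'i set" and Y :: "'i \<Rightarrow> 'a \<Rightarrow> 'b :: topological_space"
  assumes indep: "indep_vars (\<lambda>_. borel) Y I"
    and A: "A \<in> sets borel" and p: "\<And>i. i \<in> I \<Longrightarrow> prob {\<omega> \<in> space M. Y i \<omega> \<in> A} = p"
    and K: "\<And>j. j < m \<Longrightarrow> finite (K j) \<and> K j \<noteq> {} \<and> K j \<subseteq> I \<and> card (K j) \<le> k"
    and disj: "disjoint_family_on K {..<m}"
  shows "prob {\<omega> \<in> space M. \<forall>j<m. \<exists>i\<in>K j. Y i \<omega> \<notin> A} \<le> (1 - p ^ k) ^ m"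
proof (cases "m = 0")
  case False
  define Z where "Z = (\<lambda>j \<omega>. restrict (\<lambda>i. Y i \<omega>) (K j))"
  define B where "B = (\<lambda>j. {f \<in> space (PiM (K j) (\<lambda>_. borel)). \<exists>i\<in>K j. f i \<notin> A})"
  have indepZ: "indep_vars (\<lambda>j. PiM (K j) (\<lambda>_. borel)) Z {..<m}"
    unfolding Z_def using K by (intro indep_vars_restrict[OF indep _ disj]) auto
  have rv: "Y i \<in> borel_measurable M" if "i \<in> I" for i
    using indep that by (auto simp: indep_vars_def)
  have B: "B j \<in> sets (PiM (K j) (\<lambda>_. borel))" if "j < m" for j
  proof -
    have "(\<lambda>f. f i) -` (- A) \<inter> space (PiM (K j) (\<lambda>_. borel)) \<in> sets (PiM (K j) (\<lambda>_. borel))"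
      if "i \<in> K j" for i
      using A that by (intro measurable_sets[OF measurable_component_singleton]) auto
    then have "(\<Union>i\<in>K j. (\<lambda>f. f i) -` (- A) \<inter> space (PiM (K j) (\<lambda>_. borel)))
        \<in> sets (PiM (K j) (\<lambda>_. borel))"
      using K[OF that] by (intro sets.finite_UN) auto
    also have "(\<Union>i\<in>K j. (\<lambda>f. f i) -` (- A) \<inter> space (PiM (K j) (\<lambda>_. borel))) = B j"
      by (auto simp: B_def)
    finally show ?thesis .
  qed
  have block: "prob (Z j -` B j \<inter> space M) \<le> 1 - p ^ k" if "j < m" for j
  proof -
    note Kj = K[OF that]
    obtain i0 where i0: "i0 \<in> K j" using Kj by blast
    have p01: "0 \<le> p" "p \<le> 1"
      using p[of i0] i0 Kj by (metis measure_nonneg subset_iff, metis prob_le_1 subset_iff)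
    have ev: "(\<Inter>i\<in>K j. Y i -` A \<inter> space M) \<in> events"
      using Kj A rv by (intro sets.finite_INT) (auto intro!: measurable_sets)
    have "Z j -` B j \<inter> space M = space M - (\<Inter>i\<in>K j. Y i -` A \<inter> space M)"
      using i0 by (auto simp: Z_def B_def space_PiM)
    then have "prob (Z j -` B j \<inter> space M) = 1 - prob (\<Inter>i\<in>K j. Y i -` A \<inter> space M)"
      using prob_compl[OF ev] by simp
    also have "prob (\<Inter>i\<in>K j. Y i -` A \<inter> space M) = (\<Prod>i\<in>K j. prob (Y i -` A \<inter> space M))"
      using Kj A by (intro indep_varsD[OF indep]) auto
    also have "\<dots> = (\<Prod>i\<in>K j. p)"
    proof (rule prod.cong[OF refl])
      fix i assume "i \<in> K j"
      moreover have "Y i -` A \<inter> space M = {\<omega> \<in> space M. Y i \<omega> \<in> A}" by auto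
      ultimately show "prob (Y i -` A \<inter> space M) = p"
        using p[of i] Kj by auto
    qed
    also have "\<dots> = p ^ card (K j)"
      by simp
    also have "1 - p ^ card (K j) \<le> 1 - p ^ k"
      using Kj p01 by (simp add: power_decreasing)
    finally show ?thesis .
  qed
  have "{\<omega> \<in> space M. \<forall>j<m. \<exists>i\<in>K j. Y i \<omega> \<notin> A} = (\<Inter>j\<in>{..<m}. Z j -` B j \<inter> space M)"
    using False by (auto simp: Z_def B_def space_PiM)
  then have "prob {\<omega> \<in> space M. \<forall>j<m. \<exists>i\<in>K j. Y i \<omega> \<notin> A}
      = prob (\<Inter>j\<in>{..<m}. Z j -` B j \<inter> space M)"
    by simp
  also have "\<dots> = (\<Prod>j<m. prob (Z j -` B j \<inter> space M))"
    using False B by (intro indep_varsD[OF indepZ]) auto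
  also have "\<dots> \<le> (\<Prod>j<m. 1 - p ^ k)"
    using block by (intro prod_mono) auto
  finally show ?thesis
    by simp
qed simp

lemma countable_integer_lines: "countable (integer_lines :: (int ^ 'd) set set)"
proof -
  have "(integer_lines :: (int ^ 'd) set set) \<subseteq> (\<lambda>(x, i). coordinate_line x i) ` UNIV"
    by (auto simp: integer_lines_def)
  then show ?thesis
    by (rule countable_subset) auto
qed

locale iid_line_times = prob_space M + N: prob_space N
  for M :: "'w measure" and N :: "'v measure" +
  fixes tau :: "(int ^ 'd) set \<Rightarrow> 'w \<Rightarrow> ennreal" and X :: "'v \<Rightarrow> ennreal"
  assumes X: "X \<in> borel_measurable N"
    and indep: "indep_vars (\<lambda>_. borel) tau integer_lines"
    and ident: "\<And>\<delta>. \<delta> \<in> integer_lines \<Longrightarrow> distr M borel (tau \<delta>) = distr N borel X"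
begin

lemma tau_measurable: "\<delta> \<in> integer_lines \<Longrightarrow> tau \<delta> \<in> borel_measurable M"
  using indep by (auto simp: indep_vars_def)

lemma law:
  assumes "\<delta> \<in> integer_lines" "A \<in> sets borel"
  shows "prob {\<omega> \<in> space M. tau \<delta> \<omega> \<in> A} = measure N {v \<in> space N. X v \<in> A}"
proof -
  have "prob {\<omega> \<in> space M. tau \<delta> \<omega> \<in> A} = measure (distr M borel (tau \<delta>)) A"
    using assms tau_measurable by (simp add: measure_distr vimage_def Int_def conj_commute)
  also have "\<dots> = measure N {v \<in> space N. X v \<in> A}"
    using assms X by (simp add: ident measure_distr vimage_def Int_def conj_commute)
  finally show ?thesis .
qed

lemma event_line:
  assumes "A \<in> sets borel"
  shows "{\<omega> \<in> space M. tau (coordinate_line z i) \<omega> \<in> A} \<in> events"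
proof -
  have "tau (coordinate_line z i) -` A \<inter> space M \<in> events"
    using tau_measurable[OF coordinate_line_in_integer_lines] assms by (rule measurable_sets)
  moreover have "tau (coordinate_line z i) -` A \<inter> space M
      = {\<omega> \<in> space M. tau (coordinate_line z i) \<omega> \<in> A}" by auto
  ultimately show ?thesis by simp
qed

text \<open>There are only countably many paths.\<close>

lemma passage_time_measurable: "(\<lambda>\<omega>. passage_time (\<lambda>\<delta>. tau \<delta> \<omega>) x y) \<in> borel_measurable M"
proof -
  have edge: "(\<lambda>\<omega>. edge_time (\<lambda>\<delta>. tau \<delta> \<omega>) e) \<in> borel_measurable M" if "e \<in> edges" for e
    unfolding edge_time_def using theI'[OF edge_in_unique_line[OF that]]
    by (intro tau_measurable) auto
  have path: "(\<lambda>\<omega>. path_time (\<lambda>\<delta>. tau \<delta> \<omega>) p) \<in> borel_measurable M" if "lattice_path x y p" for p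
    unfolding path_time_def
  proof (intro borel_measurable_sum edge)
    fix k assume "k \<in> {..<length p - 1}"
    then have "adjacent (p ! k) (p ! Suc k)"
      using that by (auto simp: lattice_path_def successively_conv_nth)
    then show "{p ! k, p ! Suc k} \<in> edges"
      by (auto simp: edges_def)
  qed
  show ?thesis
    unfolding passage_time_def
    by (intro borel_measurable_INF path) auto
qed

lemma prob_line_near_in_le:
  fixes R :: nat and y :: "int ^ 'd"
  assumes A: "A \<in> sets borel"
  defines "E \<equiv> {\<omega> \<in> space M. \<exists>w\<in>cube (int R). \<exists>i. tau (coordinate_line (y + w) i) \<omega> \<in> A}"
  shows "E \<in> events"
    and "prob E \<le> real (card (cube (int R) :: (int ^ 'd) set)) * real CARD('d)
      * measure N {v \<in> space N. X v \<in> A}"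
proof -
  let ?F = "\<lambda>(w, i). {\<omega> \<in> space M. tau (coordinate_line (y + w) i) \<omega> \<in> A}"
  let ?J = "(cube (int R) :: (int ^ 'd) set) \<times> (UNIV :: 'd set)"
  have fin: "finite ?J"
    by (simp add: finite_cube)
  have E: "E = (\<Union>q\<in>?J. ?F q)"
    by (auto simp: E_def)
  have F: "?F q \<in> events" for q
    using event_line[OF A] by (cases q) auto
  show "E \<in> events"
    unfolding E using fin F by (intro sets.finite_UN) auto
  have "prob E \<le> (\<Sum>q\<in>?J. prob (?F q))"
    unfolding E using F by (intro finite_measure_subadditive_finite fin) blast
  also have "\<dots> = (\<Sum>q\<in>?J. measure N {v \<in> space N. X v \<in> A})"
    by (rule sum.cong[OF refl]) (simp add: case_prod_unfold law[OF coordinate_line_in_integer_lines A])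
  also have "\<dots> = real (card (cube (int R) :: (int ^ 'd) set)) * real CARD('d)
      * measure N {v \<in> space N. X v \<in> A}"
    by (simp add: card_cartesian_product)
  finally show "prob E \<le> \<dots>" .
qed

lemma prob_no_finite_line_near_le:
  fixes R :: nat and y :: "int ^ 'd" and i j :: 'd
  assumes ij: "i \<noteq> j"
  defines "E \<equiv> {\<omega> \<in> space M. \<forall>k<R. \<not> tau (coordinate_line (y + axis i (int k)) j) \<omega> < \<infinity>}"
  shows "E \<in> events"
    and "prob E \<le> (1 - measure N {v \<in> space N. X v < \<infinity>}) ^ R"
proof -
  have "E = space M - (\<Union>k\<in>{..<R}.
      {\<omega> \<in> space M. tau (coordinate_line (y + axis i (int k)) j) \<omega> \<in> {..<\<infinity>}})"
    by (auto simp: E_def)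
  then show "E \<in> events"
    by (simp only:) (intro sets.Diff sets.top sets.finite_UN event_line, auto)
  define K where "K = (\<lambda>k. {coordinate_line (y + axis i (int k)) j})"
  have disj: "disjoint_family_on K {..<R}"
    unfolding disjoint_family_on_def
  proof (intro ballI impI)
    fix k l :: nat assume "k \<noteq> l"
    then show "K k \<inter> K l = {}"
      using coordinate_line_eqD[OF _ ij, of "y + axis i (int k)" "y + axis i (int l)"]
      by (auto simp: K_def)
  qed
  have "prob {\<omega> \<in> space M. \<forall>k<R. \<exists>\<delta>\<in>K k. tau \<delta> \<omega> \<notin> {..<\<infinity>}}
      \<le> (1 - measure N {v \<in> space N. X v \<in> {..<\<infinity>}} ^ 1) ^ R"
  proof (rule prob_no_block_succeeds_le[OF indep _ law _ disj])
    show "finite (K k) \<and> K k \<noteq> {} \<and> K k \<subseteq> integer_lines \<and> card (K k) \<le> 1" for k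
      by (auto simp: K_def coordinate_line_in_integer_lines)
  qed auto
  then show "prob E \<le> (1 - measure N {v \<in> space N. X v < \<infinity>}) ^ R"
    by (simp add: E_def K_def)
qed

text \<open>A union bound over all pairs of points and of directions. For a fixed pair, the blocks of at most
  two lines that belong to different shifts are disjoint, because the two points have the same \<open>i\<close>-th
  coordinate: a line that occurs for the shift \<open>k\<close> determines \<open>k\<close>. The two lines of one block may
  coincide, which only increases the probability that both are fast.\<close>

lemma prob_not_well_connected_le:
  fixes r :: int and c :: ennreal and m :: nat
  defines "E \<equiv> {\<omega> \<in> space M. \<not> well_connected (\<lambda>\<delta>. tau \<delta> \<omega>) c m (cube r)}"
  shows "E \<in> events"
    and "prob E \<le> (real (nat (2 * r + 1)) ^ CARD('d)) ^ 2 * real CARD('d) ^ 2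
      * (1 - measure N {v \<in> space N. X v \<le> c} ^ 2) ^ m"
proof -
  define p where "p = measure N {v \<in> space N. X v \<le> c}"
  define K where "K = (\<lambda>(z :: int ^ 'd, w, i, j) k.
    {coordinate_line (z + axis i (int k)) j, coordinate_line (w + axis i (int k)) j})"
  define F where "F = (\<lambda>q. {\<omega> \<in> space M. \<forall>k<m. \<exists>\<delta>\<in>K q k. tau \<delta> \<omega> \<notin> {..c}})"
  define J where "J = {(z :: int ^ 'd, w :: int ^ 'd, i, j). z \<in> cube r \<and> w \<in> cube r \<and> i \<noteq> j \<and> z $ i = w $ i}"
  have sub: "J \<subseteq> cube r \<times> cube r \<times> UNIV \<times> UNIV"
    by (auto simp: J_def)
  have finC: "finite ((cube r :: (int ^ 'd) set) \<times> (cube r :: (int ^ 'd) set) \<times> (UNIV :: 'd set) \<times> (UNIV :: 'd set))"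
    by (intro finite_cartesian_product finite_cube) auto
  then have fin: "finite J"
    by (rule finite_subset[OF sub])
  have E: "E = (\<Union>q\<in>J. F q)"
    unfolding E_def F_def J_def K_def well_connected_def by fastforce
  have Ksub: "K q k \<subseteq> integer_lines" for q k
    by (cases q) (auto simp: K_def coordinate_line_in_integer_lines)
  have finK: "finite (K q k)" "K q k \<noteq> {}" "card (K q k) \<le> 2" for q k
    by (cases q; simp add: K_def card_insert_if)+
  have F: "F q \<in> events" for q
  proof -
    define G where "G = (\<lambda>k. \<Union>\<delta>\<in>K q k. tau \<delta> -` (- {..c}) \<inter> space M)"
    have G: "G k \<in> events" for k
      unfolding G_def
    proof (intro sets.finite_UN finK)
      fix \<delta> assume "\<delta> \<in> K q k"
      then have "tau \<delta> \<in> borel_measurable M"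
        using Ksub tau_measurable by blast
      then show "tau \<delta> -` (- {..c}) \<inter> space M \<in> events"
        by (rule measurable_sets) simp
    qed
    have "F q = space M - (\<Union>k\<in>{..<m}. space M - G k)"
      by (auto simp: F_def G_def not_le)
    then show ?thesis
      using G by (simp only:) (intro sets.Diff sets.top sets.finite_UN, auto)
  qed
  show "E \<in> events"
    unfolding E using fin F by (intro sets.finite_UN) auto
  have PF: "prob (F q) \<le> (1 - p ^ 2) ^ m" if "q \<in> J" for q
  proof -
    obtain z w i j where q: "q = (z, w, i, j)" by (cases q)
    have ij: "i \<noteq> j" "z $ i = w $ i"
      using that by (auto simp: J_def q)
    have disj: "disjoint_family_on (K q) {..<m}"
      unfolding disjoint_family_on_def
    proof (intro ballI impI)
      fix k l :: nat assume "k \<noteq> l"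
      then have "coordinate_line (x + axis i (int k)) j \<noteq> coordinate_line (y + axis i (int l)) j"
        if "x \<in> {z, w}" "y \<in> {z, w}" for x y
        using coordinate_line_eqD[OF _ ij(1), of "x + axis i (int k)" "y + axis i (int l)"]
          ij(2) that by auto
      then show "K q k \<inter> K q l = {}"
        by (auto simp: K_def q)
    qed
    have "prob (F q) \<le> (1 - measure N {v \<in> space N. X v \<in> {..c}} ^ 2) ^ m"
      unfolding F_def
      by (rule prob_no_block_succeeds_le[OF indep _ law _ disj]) (use finK Ksub in auto)
    then show ?thesis
      by (simp add: p_def)
  qed
  have p01: "0 \<le> 1 - p ^ 2"
    by (simp add: p_def power_le_one)
  have cardJ: "card J \<le> (nat (2 * r + 1) ^ CARD('d)) ^ 2 * CARD('d) ^ 2"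
  proof -
    have "card J \<le> card ((cube r :: (int ^ 'd) set) \<times> (cube r :: (int ^ 'd) set) \<times>
         (UNIV :: 'd set) \<times> (UNIV :: 'd set))"
      using finC sub by (rule card_mono)
    also have "\<dots> = card (cube r :: (int ^ 'd) set) ^ 2 * CARD('d) ^ 2"
      by (simp add: card_cartesian_product power2_eq_square)
    also have "\<dots> \<le> (nat (2 * r + 1) ^ CARD('d)) ^ 2 * CARD('d) ^ 2"
      by (intro mult_right_mono power_mono card_cube_le) auto
    finally show ?thesis .
  qed
  have "prob E \<le> (\<Sum>q\<in>J. prob (F q))"
    unfolding E using F by (intro finite_measure_subadditive_finite fin) blast
  also have "\<dots> \<le> real (card J) * (1 - p ^ 2) ^ m"
    using PF by (rule sum_bounded_above)
  also have "\<dots> \<le> real ((nat (2 * r + 1) ^ CARD('d)) ^ 2 * CARD('d) ^ 2) * (1 - p ^ 2) ^ m"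
    using cardJ p01 by (intro mult_right_mono of_nat_mono zero_le_power) auto
  finally show "prob E \<le> (real (nat (2 * r + 1)) ^ CARD('d)) ^ 2 * real CARD('d) ^ 2
      * (1 - measure N {v \<in> space N. X v \<le> c} ^ 2) ^ m"
    by (simp add: p_def)
qed

lemma null_line_below:
  assumes b: "measure N {v \<in> space N. X v < b} = 0"
  shows "{\<omega> \<in> space M. \<exists>\<delta>\<in>integer_lines. tau \<delta> \<omega> < b} \<in> null_sets M"
proof -
  have "{\<omega> \<in> space M. tau \<delta> \<omega> < b} \<in> null_sets M" if "\<delta> \<in> integer_lines" for \<delta>
  proof -
    have "{\<omega> \<in> space M. tau \<delta> \<omega> < b} \<in> events"
      using tau_measurable[OF that] by measurable
    moreover have "prob {\<omega> \<in> space M. tau \<delta> \<omega> < b} = 0"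
      using law[OF that, of "{..<b}"] b by simp
    ultimately show ?thesis
      by (simp add: null_sets_def emeasure_eq_measure)
  qed
  then have "(\<Union>\<delta>\<in>integer_lines. {\<omega> \<in> space M. tau \<delta> \<omega> < b}) \<in> null_sets M"
    by (intro null_sets_UN' countable_integer_lines)
  also have "(\<Union>\<delta>\<in>integer_lines. {\<omega> \<in> space M. tau \<delta> \<omega> < b})
      = {\<omega> \<in> space M. \<exists>\<delta>\<in>integer_lines. tau \<delta> \<omega> < b}" by auto
  finally show ?thesis .
qed

end

section \<open>The deviation bound for fixed parameters\<close>

text \<open>Here \<open>u\<close> and \<open>v\<close> stand for the vertices closest to \<open>y\<close> and \<open>z\<close>. A finite line that meets a
  segment of length \<open>R\<close> from \<open>y\<close> forces \<open>u\<close> to be within distance \<open>R\<close> of \<open>y\<close>; and since \<open>u\<close> lies on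
  some finite line, which then passes near \<open>y\<close>, that line is not slower than \<open>\<kappa>\<close>.\<close>

lemma passage_time_sandwich:
  fixes t :: "(int ^ 'd) set \<Rightarrow> ennreal" and u v y z :: "int ^ 'd" and R m :: nat
  assumes dim: "2 \<le> CARD('d)"
    and wc: "well_connected t (ennreal \<gamma>) m (cube r)" and \<gamma>: "0 \<le> \<gamma>" "\<gamma> \<le> \<kappa>"
    and b: "0 \<le> b" "\<And>\<delta>. \<delta> \<in> integer_lines \<Longrightarrow> ennreal b \<le> t \<delta>"
    and u: "finite_vertices t \<noteq> {} \<Longrightarrow> u \<in> closest_vertices t y"
      "\<exists>k<R. t (coordinate_line (y + axis i (int k)) j) < \<infinity>"
      "\<not> (\<exists>w\<in>cube (int R). \<exists>i. t (coordinate_line (y + w) i) \<in> {ennreal \<kappa><..<\<infinity>})"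
      "\<And>l. \<bar>y $ l\<bar> + int R + 3 * int m \<le> r"
    and v: "finite_vertices t \<noteq> {} \<Longrightarrow> v \<in> closest_vertices t z"
      "\<exists>k<R. t (coordinate_line (z + axis i (int k)) j) < \<infinity>"
      "\<not> (\<exists>w\<in>cube (int R). \<exists>i. t (coordinate_line (z + w) i) \<in> {ennreal \<kappa><..<\<infinity>})"
      "\<And>l. \<bar>z $ l\<bar> + int R + 3 * int m \<le> r"
  shows "ennreal (b * (real_of_int (l1_norm (y - z)) - 2 * real R)) \<le> passage_time t u v"
    and "passage_time t u v \<le> ennreal (\<kappa> * (4 * real m)
      + \<gamma> * (real_of_int (l1_norm (y - z)) + 2 * real R + 4 * real m + 2 * real m * real CARD('d)))"
proof -
  have near: "l1_norm (s - y') \<le> int R \<and> (\<exists>i. t (coordinate_line s i) \<le> ennreal \<kappa>)"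
    if s: "finite_vertices t \<noteq> {} \<Longrightarrow> s \<in> closest_vertices t y'"
      and fin: "\<exists>k<R. t (coordinate_line (y' + axis i (int k)) j) < \<infinity>"
      and slow: "\<not> (\<exists>w\<in>cube (int R). \<exists>i. t (coordinate_line (y' + w) i) \<in> {ennreal \<kappa><..<\<infinity>})"
    for s y' :: "int ^ 'd"
  proof -
    obtain k where k: "k < R" "t (coordinate_line (y' + axis i (int k)) j) < \<infinity>"
      using fin by blast
    have le: "l1_norm (s - y') \<le> int R"
      by (rule closest_vertex_near(1)[OF s k])
    obtain i' where i': "t (coordinate_line s i') < \<infinity>"
      using closest_vertex_near(2)[OF s k] by blast
    have "s - y' \<in> cube (int R)"
      unfolding cube_def using abs_component_le_l1_norm[of "s - y'"] le order_trans by blast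
    with slow have "t (coordinate_line (y' + (s - y')) i') \<notin> {ennreal \<kappa><..<\<infinity>}"
      by blast
    then have "t (coordinate_line s i') \<le> ennreal \<kappa>"
      using i' by (auto simp: not_less top_unique)
    with le show ?thesis by blast
  qed
  obtain iu where uR: "l1_norm (u - y) \<le> int R" and iu: "t (coordinate_line u iu) \<le> ennreal \<kappa>"
    using near[OF u(1-3)] by blast
  obtain iv where vR: "l1_norm (v - z) \<le> int R" and iv: "t (coordinate_line v iv) \<le> ennreal \<kappa>"
    using near[OF v(1-3)] by blast
  have l1: "l1_norm (u - v) \<le> l1_norm (y - z) + 2 * int R" "l1_norm (y - z) - 2 * int R \<le> l1_norm (u - v)"
    using l1_norm_triangle[of u v y] l1_norm_triangle[of y v z] l1_norm_triangle[of y z u]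
      l1_norm_triangle[of u z v] l1_norm_minus_commute[of z v] l1_norm_minus_commute[of u y] uR vR
    by auto
  define n where "n = nat (l1_norm (u - v))"
  have n: "real n \<le> real_of_int (l1_norm (y - z)) + 2 * real R"
    "real_of_int (l1_norm (y - z)) - 2 * real R \<le> real n"
    using l1 l1_norm_nonneg[of "u - v"] unfolding n_def by linarith+
  have "ennreal (b * (real_of_int (l1_norm (y - z)) - 2 * real R)) \<le> ennreal (b * real n)"
    using n b(1) by (intro ennreal_leI mult_left_mono) auto
  also have "\<dots> = ennreal b * of_nat n"
    using b(1) by (simp add: ennreal_mult ennreal_of_nat_eq_real_of_nat)
  also have "\<dots> \<le> passage_time t u v"
    unfolding n_def using b(2) by (rule passage_time_lower_bound)
  finally show "ennreal (b * (real_of_int (l1_norm (y - z)) - 2 * real R)) \<le> passage_time t u v" .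
  have "\<bar>u $ l\<bar> \<le> r - 3 * int m" "\<bar>v $ l\<bar> \<le> r - 3 * int m" for l
    using component_le_l1_norm_diff[of u l y] component_le_l1_norm_diff[of v l z] uR vR
      u(4)[of l] v(4)[of l] by auto
  from passage_time_upper_bound[OF dim wc ennreal_leI[OF \<gamma>(2)] this(1) iu this(2) iv]
  have "passage_time t u v
      \<le> ennreal \<kappa> * of_nat (4 * m) + ennreal \<gamma> * of_nat (n + 4 * m + 2 * m * CARD('d))"
    by (simp only: n_def)
  also have "\<dots> = ennreal (\<kappa> * real (4 * m) + \<gamma> * real (n + 4 * m + 2 * m * CARD('d)))"
    using \<gamma> by (simp only: ennreal_of_nat_eq_real_of_nat ennreal_mult[symmetric] ennreal_plus[symmetric]
      of_nat_0_le_iff mult_nonneg_nonneg order_trans[OF \<gamma>])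
  also have "\<dots> \<le> ennreal (\<kappa> * (4 * real m)
      + \<gamma> * (real_of_int (l1_norm (y - z)) + 2 * real R + 4 * real m + 2 * real m * real CARD('d)))"
    using n(1) \<gamma> by (intro ennreal_leI add_mono mult_left_mono) auto
  finally show "passage_time t u v \<le> ennreal (\<kappa> * (4 * real m)
      + \<gamma> * (real_of_int (l1_norm (y - z)) + 2 * real R + 4 * real m + 2 * real m * real CARD('d)))" .
qed

lemma abs_quotient_diff_le:
  fixes T :: ennreal and n :: nat
  assumes n: "0 < n" and T: "ennreal l \<le> T" "T \<le> ennreal h"
    and h: "0 \<le> h" "h / real n \<le> s + \<epsilon>" and l: "s - \<epsilon> \<le> l / real n"
  shows "\<bar>enn2ereal (T / of_nat n) - ereal s\<bar> \<le> ereal \<epsilon>"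
proof -
  obtain \<rho> where \<rho>: "0 \<le> \<rho>" "T = ennreal \<rho>"
    using T(2) by (metis ennreal_cases ennreal_less_top leD top.not_eq_extremum)
  have b: "l \<le> \<rho>" "\<rho> \<le> h"
    using T h(1) \<rho> by (auto simp: ennreal_le_iff2)
  have "T / of_nat n = ennreal (\<rho> / real n)"
    using \<rho> n by (simp add: ennreal_of_nat_eq_real_of_nat divide_ennreal)
  then have *: "enn2ereal (T / of_nat n) = ereal (\<rho> / real n)"
    using \<rho>(1) by simp
  have "\<rho> / real n \<le> h / real n" "l / real n \<le> \<rho> / real n"
    using b n by (auto intro: divide_right_mono)
  then show ?thesis
    unfolding * using h(2) l by (simp add: abs_le_iff)
qed

context iid_line_times
begin

text \<open>The deviation event is covered by six exceptional events: the cube around both endpoints is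
  not well connected, at one of the two endpoints all the parallel lines that cross a segment of length \<open>R\<close> are
  infinite, one of the two endpoints is close to a line whose time is finite but exceeds \<open>\<kappa>\<close>, or some line is faster
  than \<open>b\<close>. The last event is null; the others give the three summands.\<close>

lemma prob_deviation_le:
  fixes star :: "int ^ 'd \<Rightarrow> 'w \<Rightarrow> int ^ 'd" and x :: "int ^ 'd" and n m R :: nat
  assumes dim: "2 \<le> CARD('d)"
    and star: "\<And>y \<omega>. \<omega> \<in> space M \<Longrightarrow> finite_vertices (\<lambda>\<delta>. tau \<delta> \<omega>) \<noteq> {} \<Longrightarrow>
      star y \<omega> \<in> closest_vertices (\<lambda>\<delta>. tau \<delta> \<omega>) y"
    and \<gamma>: "0 \<le> \<gamma>" "\<gamma> \<le> \<kappa>"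
    and b: "0 \<le> b" "measure N {v \<in> space N. X v < ennreal b} = 0"
    and n: "0 < n"
    and upper: "(\<kappa> * (4 * real m) + \<gamma> * (real n * real_of_int (l1_norm x) + 2 * real R
      + 4 * real m + 2 * real m * real CARD('d))) / real n \<le> s + \<epsilon>"
    and lower: "s - \<epsilon> \<le> b * (real n * real_of_int (l1_norm x) - 2 * real R) / real n"
  shows "prob {\<omega> \<in> space M. ereal \<epsilon> < \<bar>enn2ereal
        (passage_time (\<lambda>\<delta>. tau \<delta> \<omega>) (star 0 \<omega>) (star (int n *s x) \<omega>) / of_nat n) - ereal s\<bar>}
    \<le> (real (nat (2 * (int n * l1_norm x + int R + 3 * int m) + 1)) ^ CARD('d)) ^ 2
        * real CARD('d) ^ 2 * (1 - measure N {v \<in> space N. X v \<le> ennreal \<gamma>} ^ 2) ^ m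
      + 2 * (1 - measure N {v \<in> space N. X v < \<infinity>}) ^ R
      + 2 * (real (card (cube (int R) :: (int ^ 'd) set)) * real CARD('d)
        * measure N {v \<in> space N. X v \<in> {ennreal \<kappa><..<\<infinity>}})"
    (is "prob ?dev \<le> ?P1 + 2 * ?P2 + 2 * ?P3")
proof -
  define r where "r = int n * l1_norm x + int R + 3 * int m"
  define z where "z = int n *s x"
  obtain i j :: 'd where ij: "i \<noteq> j"
    using obtain_other_direction[OF dim] by metis
  define B1 where "B1 =
    {\<omega> \<in> space M. \<not> well_connected (\<lambda>\<delta>. tau \<delta> \<omega>) (ennreal \<gamma>) m (cube r)}"
  define B2 where "B2 = (\<lambda>y.
    {\<omega> \<in> space M. \<forall>k<R. \<not> tau (coordinate_line (y + axis i (int k)) j) \<omega> < \<infinity>})"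
  define B3 where "B3 = (\<lambda>y. {\<omega> \<in> space M. \<exists>w\<in>cube (int R). \<exists>i.
    tau (coordinate_line (y + w) i) \<omega> \<in> {ennreal \<kappa><..<\<infinity>}})"
  define B4 where "B4 = {\<omega> \<in> space M. \<exists>\<delta>\<in>integer_lines. tau \<delta> \<omega> < ennreal b}"
  have sets: "B1 \<in> events" "B2 y \<in> events" "B3 y \<in> events" "B4 \<in> events" for y
    unfolding B1_def B2_def B3_def B4_def
    by (rule prob_not_well_connected_le prob_no_finite_line_near_le(1)[OF ij]
      prob_line_near_in_le null_setsD2[OF null_line_below[OF b(2)]]; simp)+
  have P1: "prob B1 \<le> ?P1"
    unfolding B1_def r_def by (rule prob_not_well_connected_le)
  have P2: "prob (B2 y) \<le> ?P2" for y
    unfolding B2_def by (rule prob_no_finite_line_near_le(2)[OF ij])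
  have P3: "prob (B3 y) \<le> ?P3" for y
    unfolding B3_def by (rule prob_line_near_in_le) simp
  have P4: "prob B4 = 0"
    using null_line_below[OF b(2)] unfolding B4_def by (simp add: null_sets_def measure_def)
  have "?dev \<subseteq> B1 \<union> B2 0 \<union> B2 z \<union> B3 0 \<union> B3 z \<union> B4"
  proof (rule subsetI, rule ccontr)
    fix \<omega> assume \<omega>: "\<omega> \<in> ?dev" and good: "\<omega> \<notin> B1 \<union> B2 0 \<union> B2 z \<union> B3 0 \<union> B3 z \<union> B4"
    define t where "t = (\<lambda>\<delta>. tau \<delta> \<omega>)"
    have sp: "\<omega> \<in> space M"
      using \<omega> by simp
    have connected: "well_connected t (ennreal \<gamma>) m (cube r)"
      using good sp by (simp add: B1_def t_def)
    have finite_near: "\<exists>k<R. t (coordinate_line (y + axis i (int k)) j) < \<infinity>" if "y \<in> {0, z}" for y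
      using good sp that by (auto simp: B2_def t_def)
    have not_slow: "\<not> (\<exists>w\<in>cube (int R). \<exists>i. t (coordinate_line (y + w) i) \<in> {ennreal \<kappa><..<\<infinity>})"
      if "y \<in> {0, z}" for y
      using good sp that unfolding B3_def t_def by blast
    have not_below: "ennreal b \<le> t \<delta>" if "\<delta> \<in> integer_lines" for \<delta>
      using good sp that by (auto simp: B4_def t_def not_less)
    have close: "finite_vertices t \<noteq> {} \<Longrightarrow> star y \<omega> \<in> closest_vertices t y" for y
      unfolding t_def by (rule star[OF sp])
    have l1: "l1_norm (0 - z) = int n * l1_norm x"
      by (subst l1_norm_minus_commute) (simp add: l1_norm_scale z_def)
    have inside: "\<bar>y $ l\<bar> + int R + 3 * int m \<le> r" if "y \<in> {0, z}" for y l
      using that abs_component_le_l1_norm[of z l] l1_norm_nonneg[of z]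
      by (auto simp: r_def z_def l1_norm_scale)
    have y: "0 \<in> {0, z}" "z \<in> {0, z}"
      by auto
    note sandwich = passage_time_sandwich[OF dim connected \<gamma> b(1) not_below
        close finite_near[OF y(1)] not_slow[OF y(1)] inside[OF y(1)]
        close finite_near[OF y(2)] not_slow[OF y(2)] inside[OF y(2)], unfolded l1]
    define T where "T = passage_time t (star 0 \<omega>) (star z \<omega>)"
    have "\<bar>enn2ereal (T / of_nat n) - ereal s\<bar> \<le> ereal \<epsilon>"
    proof (rule abs_quotient_diff_le[OF n _ _ _ upper lower])
      show "ennreal (b * (real n * real_of_int (l1_norm x) - 2 * real R)) \<le> T"
        using sandwich(1) by (simp add: T_def)
      show "T \<le> ennreal (\<kappa> * (4 * real m) + \<gamma> * (real n * real_of_int (l1_norm x) + 2 * real R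
          + 4 * real m + 2 * real m * real CARD('d)))"
        using sandwich(2) by (simp add: T_def)
      show "0 \<le> \<kappa> * (4 * real m) + \<gamma> * (real n * real_of_int (l1_norm x) + 2 * real R
          + 4 * real m + 2 * real m * real CARD('d))"
        using \<gamma> l1_norm_nonneg[of x] by simp
    qed
    then show False
      using \<omega> unfolding T_def t_def z_def mem_Collect_eq by (metis leD)
  qed
  then have "prob ?dev \<le> prob (B1 \<union> B2 0 \<union> B2 z \<union> B3 0 \<union> B3 z \<union> B4)"
    using sets by (intro finite_measure_mono) auto
  also have "\<dots> \<le> prob B1 + prob (B2 0) + prob (B2 z) + prob (B3 0) + prob (B3 z) + prob B4"
    using sets by (intro order_trans[OF measure_Un_le] add_mono order_refl sets.Un) auto
  also have "\<dots> \<le> ?P1 + 2 * ?P2 + 2 * ?P3"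
    using P1 P2[of 0] P2[of z] P3[of 0] P3[of z] P4 by linarith
  finally show ?thesis .
qed

end

section \<open>Asymptotics\<close>

text \<open>The length of the windows in which fast lines are sought. It is \<open>o(n)\<close>, so that the detours
  are negligible, and of a polynomial order, so that a failure probability exponentially small in
  the window length beats the polynomial number of windows in a cube of side \<open>O(n)\<close>.\<close>

definition window :: "nat \<Rightarrow> nat" where
  "window n = nat \<lfloor>sqrt (real n)\<rfloor>"

lemma window_le: "real (window n) \<le> sqrt (real n)"
  and window_ge: "sqrt (real n) - 1 \<le> real (window n)"
  by (simp_all add: window_def)

text \<open>The threshold beyond which a finite line near an endpoint counts as slow. It tends to
  infinity, but even a window walked along a line with this time costs only \<open>o(n)\<close>.\<close>

definition slow_threshold :: "real \<Rightarrow> nat \<Rightarrow> real" where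
  "slow_threshold \<gamma> n = sqrt (sqrt (real n)) + \<gamma>"

lemma upper_bound_rate:
  fixes \<gamma> L R D :: real
  assumes \<gamma>: "0 \<le> \<gamma>"
  shows "(\<lambda>n. (slow_threshold \<gamma> n * (4 * real (window n))
      + \<gamma> * (real n * L + 2 * R + 4 * real (window n) + 2 * real (window n) * D)) / real n)
    \<longlonglongrightarrow> \<gamma> * L"
proof -
  let ?\<kappa> = "slow_threshold \<gamma>"
  have "(\<lambda>n. real (window n) / real n) \<longlonglongrightarrow> 0"
  proof (rule tendsto_sandwich[of "\<lambda>_. 0"])
    show "(\<lambda>n. sqrt (real n) / real n) \<longlonglongrightarrow> 0"
      by real_asymp
  qed (use window_le in \<open>auto intro!: always_eventually divide_right_mono\<close>)
  moreover have "(\<lambda>n. ?\<kappa> n * real (window n) / real n) \<longlonglongrightarrow> 0"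
  proof (rule tendsto_sandwich[of "\<lambda>_. 0"])
    show "(\<lambda>n. ?\<kappa> n * sqrt (real n) / real n) \<longlonglongrightarrow> 0"
      unfolding slow_threshold_def by real_asymp
    have "0 \<le> ?\<kappa> n" for n
      using \<gamma> by (simp add: slow_threshold_def)
    then show "\<forall>\<^sub>F n in sequentially. ?\<kappa> n * real (window n) / real n \<le> ?\<kappa> n * sqrt (real n) / real n"
      "\<forall>\<^sub>F n in sequentially. 0 \<le> ?\<kappa> n * real (window n) / real n"
      using window_le by (auto intro!: always_eventually divide_right_mono mult_left_mono)
  qed auto
  moreover have "(\<lambda>n. 1 / real n) \<longlonglongrightarrow> 0"
    by real_asymp
  ultimately have lim: "(\<lambda>n. 4 * (?\<kappa> n * real (window n) / real n)
        + \<gamma> * (L + 2 * R * (1 / real n) + (4 + 2 * D) * (real (window n) / real n)))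
      \<longlonglongrightarrow> 4 * 0 + \<gamma> * (L + 2 * R * 0 + (4 + 2 * D) * 0)"
    by (intro tendsto_intros)
  have "\<forall>\<^sub>F n in sequentially. 4 * (?\<kappa> n * real (window n) / real n)
        + \<gamma> * (L + 2 * R * (1 / real n) + (4 + 2 * D) * (real (window n) / real n))
      = (?\<kappa> n * (4 * real (window n))
        + \<gamma> * (real n * L + 2 * R + 4 * real (window n) + 2 * real (window n) * D)) / real n"
    using eventually_gt_at_top[of 0] by eventually_elim (simp add: field_simps)
  from Lim_transform_eventually[OF lim this] show ?thesis
    by simp
qed

lemma lower_bound_rate:
  fixes b L R :: real
  shows "(\<lambda>n. b * (real n * L - 2 * R) / real n) \<longlonglongrightarrow> b * L"
proof -
  have "(\<lambda>n. 1 / real n) \<longlonglongrightarrow> 0"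
    by real_asymp
  then have lim: "(\<lambda>n. b * (L - 2 * R * (1 / real n))) \<longlonglongrightarrow> b * (L - 2 * R * 0)"
    by (intro tendsto_intros)
  have "\<forall>\<^sub>F n in sequentially. b * (L - 2 * R * (1 / real n)) = b * (real n * L - 2 * R) / real n"
    using eventually_gt_at_top[of 0] by eventually_elim (simp add: field_simps)
  from Lim_transform_eventually[OF lim this] show ?thesis
    by simp
qed

lemma power_times_exp_sqrt_tendsto_0:
  fixes p C :: real and k :: nat
  assumes "0 < p"
  shows "(\<lambda>n. (C * real n) ^ k * exp (- p * (sqrt (real n) - 1))) \<longlonglongrightarrow> 0"
proof -
  have "(\<lambda>n. real n powr real k * exp (- p * (sqrt (real n) - 1))) \<longlonglongrightarrow> 0"
    using assms by real_asymp
  then have lim: "(\<lambda>n. C ^ k * (real n powr real k * exp (- p * (sqrt (real n) - 1)))) \<longlonglongrightarrow> C ^ k * 0"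
    by (rule tendsto_mult_left)
  have "\<forall>\<^sub>F n in sequentially. C ^ k * (real n powr real k * exp (- p * (sqrt (real n) - 1)))
      = (C * real n) ^ k * exp (- p * (sqrt (real n) - 1))"
    using eventually_gt_at_top[of 0]
    by eventually_elim (simp add: powr_realpow power_mult_distrib)
  from Lim_transform_eventually[OF lim this] show ?thesis
    by simp
qed

text \<open>By \<open>1 - p \<le> e\<^sup>-\<^sup>p\<close> the bound is at most a polynomial in \<open>n\<close> times a stretched exponential.\<close>

lemma not_well_connected_bound_tendsto_0:
  fixes L :: int and p :: real and R k :: nat
  assumes L: "0 \<le> L" and p: "0 < p" "p \<le> 1"
  shows "(\<lambda>n. (real (nat (2 * (int n * L + int R + 3 * int (window n)) + 1)) ^ k) ^ 2 * D
    * (1 - p) ^ window n) \<longlonglongrightarrow> 0"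
proof -
  define f where
    "f = (\<lambda>n. (real (nat (2 * (int n * L + int R + 3 * int (window n)) + 1)) ^ k) ^ 2
      * (1 - p) ^ window n)"
  \<comment> \<open>The side length is at most \<open>c n\<close>: the constant 7 collects \<open>6 window n \<le> 6 n\<close> and \<open>1 \<le> n\<close>.\<close>
  define c where "c = 2 * real_of_int L + 2 * real R + 7"
  have "f \<longlonglongrightarrow> 0"
  proof (rule tendsto_sandwich[of "\<lambda>_. 0"])
    show "\<forall>\<^sub>F n in sequentially. 0 \<le> f n"
      using p by (simp add: f_def)
    show "(\<lambda>n. (c * real n) ^ (k * 2) * exp (- p * (sqrt (real n) - 1))) \<longlonglongrightarrow> 0"
      using p(1) by (rule power_times_exp_sqrt_tendsto_0)
    show "\<forall>\<^sub>F n in sequentially. f n \<le> (c * real n) ^ (k * 2) * exp (- p * (sqrt (real n) - 1))"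
      using eventually_gt_at_top[of 0]
    proof eventually_elim
      case (elim n)
      define \<rho> where "\<rho> = 2 * (int n * L + int R + 3 * int (window n)) + 1"
      have n1: "1 \<le> real n"
        using elim by simp
      have "sqrt (real n) \<le> sqrt (real n ^ 2)"
        using n1 by (intro real_sqrt_le_mono self_le_power) auto
      then have "real (window n) \<le> real n"
        using window_le[of n] by simp
      moreover have "real R \<le> real R * real n"
        using n1 by (simp add: mult_le_cancel_left1)
      moreover have "0 \<le> \<rho>"
        using L by (simp add: \<rho>_def)
      then have "real (nat \<rho>) = 2 * (real n * real_of_int L + real R + 3 * real (window n)) + 1"
        by (simp add: \<rho>_def)
      moreover have "c * real n = 2 * (real n * real_of_int L) + 2 * (real R * real n) + 7 * real n"
        by (simp add: c_def algebra_simps)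
      ultimately have "real (nat \<rho>) \<le> c * real n"
        using n1 by simp
      then have "(real (nat \<rho>) ^ k) ^ 2 \<le> (c * real n) ^ (k * 2)"
        unfolding power_mult by (intro power_mono) auto
      moreover have "(1 - p) ^ window n \<le> exp (- p * (sqrt (real n) - 1))"
      proof -
        have "(1 - p) ^ window n \<le> exp (- p) ^ window n"
          using exp_ge_add_one_self[of "- p"] p by (intro power_mono) auto
        also have "\<dots> = exp (- p * real (window n))"
          by (simp add: exp_of_nat_mult[symmetric] mult.commute)
        also have "\<dots> \<le> exp (- p * (sqrt (real n) - 1))"
          using window_ge[of n] p(1) by (simp add: mult_left_mono)
        finally show ?thesis .
      qed
      moreover have "0 \<le> (c * real n) ^ (k * 2)"
        using L by (simp add: c_def)
      ultimately show ?case
        unfolding f_def \<rho>_def[symmetric] using p by (intro mult_mono) auto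
    qed
  qed auto
  then have "(\<lambda>n. D * f n) \<longlonglongrightarrow> D * 0"
    by (rule tendsto_mult_left)
  then show ?thesis
    by (simp add: f_def mult_ac)
qed

lemma (in prob_space) measure_finite_tail_tendsto_0:
  fixes Z :: "'a \<Rightarrow> ennreal" and f :: "nat \<Rightarrow> real"
  assumes Z: "Z \<in> borel_measurable M" and f: "incseq f" "filterlim f at_top sequentially"
  shows "(\<lambda>n. measure M {v \<in> space M. Z v \<in> {ennreal (f n)<..<\<infinity>}}) \<longlonglongrightarrow> 0"
proof -
  let ?A = "\<lambda>n. {v \<in> space M. Z v \<in> {ennreal (f n)<..<\<infinity>}}"
  have "?A n \<in> sets M" for n
    using Z by measurable
  moreover have "decseq ?A"
    using f(1) by (fastforce simp: decseq_def incseq_def intro: le_less_trans[OF ennreal_leI])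
  ultimately have "(\<lambda>n. measure M (?A n)) \<longlonglongrightarrow> measure M (\<Inter>n. ?A n)"
    by (intro finite_Lim_measure_decseq) auto
  moreover have "(\<Inter>n. ?A n) = {}"
  proof (rule ccontr)
    assume "(\<Inter>n. ?A n) \<noteq> {}"
    then obtain v where v: "\<And>n. ennreal (f n) < Z v" "Z v < \<infinity>"
      by auto
    from v(2) obtain \<rho> where "0 \<le> \<rho>" "Z v = ennreal \<rho>"
      by (metis ennreal_cases infinity_ennreal_def less_irrefl)
    moreover obtain n where "\<rho> \<le> f n"
      using f(2) by (metis filterlim_at_top eventually_sequentially order_refl)
    ultimately show False
      using v(1)[of n] by (metis ennreal_leI leD)
  qed
  ultimately show ?thesis
    by simp
qed

lemma slow_threshold_at_top:
  "incseq (slow_threshold \<gamma>)" "filterlim (slow_threshold \<gamma>) at_top sequentially"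
proof -
  show "incseq (slow_threshold \<gamma>)"
    by (simp add: slow_threshold_def incseq_def)
  show "filterlim (slow_threshold \<gamma>) at_top sequentially"
    unfolding slow_threshold_def by real_asymp
qed

section \<open>Convergence in probability\<close>

text \<open>The infimum \<open>a\<close> of the support enters through two facts only: times up to \<open>a + \<eta>\<close>
  occur with positive probability, and times below \<open>a - \<eta>\<close> with probability zero. The truncation at zero
  is there because \<open>a - \<eta>\<close> may be negative.\<close>

lemma inf_support_thresholds:
  fixes X :: "'v \<Rightarrow> ennreal"
  assumes N: "prob_space N" and X: "X \<in> borel_measurable N"
    and fin: "0 < measure N {v \<in> space N. X v < \<infinity>}" and \<eta>: "0 < \<eta>"
  defines "a \<equiv> enn2real (inf_support (distr N borel X))"
  shows "0 < measure N {v \<in> space N. X v \<le> ennreal (a + \<eta>)}"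
    and "measure N {v \<in> space N. X v < ennreal (max 0 (a - \<eta>))} = 0"
proof -
  interpret N: prob_space N by (rule N)
  have a0: "0 \<le> a"
    by (simp add: a_def)
  have "enn2ereal (X v) \<le> ereal (a + \<eta>) \<longleftrightarrow> X v \<le> ennreal (a + \<eta>)" for v
    using a0 \<eta> by (simp add: less_eq_ennreal.rep_eq enn2ereal_ennreal del: ennreal_plus)
  then show "0 < measure N {v \<in> space N. X v \<le> ennreal (a + \<eta>)}"
    using inf_support_characterization(2)[OF N X fin \<eta>] by (simp add: a_def)
  have "measure N {v \<in> space N. X v < ennreal (max 0 (a - \<eta>))}
      \<le> measure N {v \<in> space N. enn2ereal (X v) \<le> ereal (a - \<eta>)}"
  proof (rule N.finite_measure_mono)
    show "{v \<in> space N. X v < ennreal (max 0 (a - \<eta>))}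
        \<subseteq> {v \<in> space N. enn2ereal (X v) \<le> ereal (a - \<eta>)}"
    proof safe
      fix v assume lt: "X v < ennreal (max 0 (a - \<eta>))"
      then have "0 < max 0 (a - \<eta>)"
        by (metis ennreal_neg leI not_less_zero)
      then have "max 0 (a - \<eta>) = a - \<eta>" "0 < a - \<eta>"
        by (auto simp: max_def split: if_splits)
      then show "enn2ereal (X v) \<le> ereal (a - \<eta>)"
        using lt by (simp add: less_ennreal.rep_eq enn2ereal_ennreal)
    qed
  qed (use X in measurable)
  also have "\<dots> = 0"
    using inf_support_characterization(3)[OF N X fin \<eta>] by (simp add: a_def)
  finally show "measure N {v \<in> space N. X v < ennreal (max 0 (a - \<eta>))} = 0"
    using measure_nonneg[of N "{v \<in> space N. X v < ennreal (max 0 (a - \<eta>))}"] by linarith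
qed

theorem theorem1p12:
  fixes M :: "'w measure" and N :: "'v measure"
    and tau :: "(int ^ 'd) set \<Rightarrow> 'w \<Rightarrow> ennreal"
    and X :: "'v \<Rightarrow> ennreal"
    and star :: "int ^ 'd \<Rightarrow> 'w \<Rightarrow> int ^ 'd"
    and x :: "int ^ 'd"
  assumes dim: "2 \<le> CARD('d)"
    and M: "prob_space M"
    and N: "prob_space N"
    and X: "X \<in> borel_measurable N"
    and indep: "prob_space.indep_vars M (\<lambda>_. borel) tau integer_lines"
    and ident: "\<And>\<delta>. \<delta> \<in> integer_lines \<Longrightarrow> distr M borel (tau \<delta>) = distr N borel X"
    and fin: "0 < measure N {v \<in> space N. X v < \<infinity>}"
    and star_measurable: "\<And>y. star y \<in> measurable M (count_space UNIV)"
    and star_closest: "\<And>y \<omega>. \<omega> \<in> space M \<Longrightarrow> finite_vertices (\<lambda>\<delta>. tau \<delta> \<omega>) \<noteq> {} \<Longrightarrow>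
      star y \<omega> \<in> closest_vertices (\<lambda>\<delta>. tau \<delta> \<omega>) y"
  shows "tendsto_in_probability M
    (\<lambda>n \<omega>. enn2ereal
      (passage_time (\<lambda>\<delta>. tau \<delta> \<omega>) (star 0 \<omega>) (star (int n *s x) \<omega>) / of_nat n))
    (enn2real (inf_support (distr N borel X)) * real_of_int (l1_norm x))"
proof -
  interpret prob_space M by (rule M)
  interpret iid_line_times M N tau X
    using N X indep ident by (intro iid_line_times.intro iid_line_times_axioms.intro M)
  define T where
    "T = (\<lambda>n \<omega>. passage_time (\<lambda>\<delta>. tau \<delta> \<omega>) (star 0 \<omega>) (star (int n *s x) \<omega>))"
  define a where "a = enn2real (inf_support (distr N borel X))"
  define L where "L = real_of_int (l1_norm x)"
  define s where "s = a * L"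
  define q where "q = measure N {v \<in> space N. X v < \<infinity>}"
  define dev where
    "dev = (\<lambda>\<epsilon> n. {\<omega> \<in> space M. ereal \<epsilon> < \<bar>enn2ereal (T n \<omega> / of_nat n) - ereal s\<bar>})"
  have a0: "0 \<le> a"
    by (simp add: a_def)
  have L0: "0 \<le> L"
    by (simp add: L_def l1_norm_nonneg)
  have T_measurable[measurable]: "T n \<in> borel_measurable M" for n
  proof -
    have "(\<lambda>\<omega>. passage_time (\<lambda>\<delta>. tau \<delta> \<omega>) u (star (int n *s x) \<omega>)) \<in> borel_measurable M" for u
      by (rule measurable_compose_countable[where f = "\<lambda>v \<omega>. passage_time (\<lambda>\<delta>. tau \<delta> \<omega>) u v",
          OF passage_time_measurable star_measurable])
    from measurable_compose_countable[where
        f = "\<lambda>u \<omega>. passage_time (\<lambda>\<delta>. tau \<delta> \<omega>) u (star (int n *s x) \<omega>)", OF this star_measurable]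
    show ?thesis
      unfolding T_def .
  qed
  have "(\<lambda>n. prob (dev \<epsilon> n)) \<longlonglongrightarrow> 0" if \<epsilon>: "0 < \<epsilon>" for \<epsilon> :: real
  proof -
    \<comment> \<open>The slack in the line times is small enough that, multiplied by the distance, it stays
      below \<open>\<epsilon>\<close>; the summand 1 covers \<open>x = 0\<close>.\<close>
    define \<eta> where "\<eta> = \<epsilon> / (L + 1)"
    have \<eta>: "0 < \<eta>" "\<eta> * L < \<epsilon>"
    proof -
      show "0 < \<eta>"
        using \<epsilon> L0 by (simp add: \<eta>_def)
      then have "\<eta> * L < \<eta> * (L + 1)"
        by simp
      also have "\<dots> = \<epsilon>"
        using L0 by (simp add: \<eta>_def)
      finally show "\<eta> * L < \<epsilon>" .
    qed
    define \<gamma> where "\<gamma> = a + \<eta>"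
    define b where "b = max 0 (a - \<eta>)"
    define p where "p = measure N {v \<in> space N. X v \<le> ennreal \<gamma>}"
    have p: "0 < p ^ 2" "p ^ 2 \<le> 1"
      using inf_support_thresholds(1)[OF N X fin \<eta>(1)]
      by (simp_all add: p_def \<gamma>_def a_def power_le_one)
    have below: "measure N {v \<in> space N. X v < ennreal b} = 0"
      unfolding b_def a_def by (rule inf_support_thresholds(2)[OF N X fin \<eta>(1)])
    have \<gamma>0: "0 \<le> \<gamma>" "\<gamma> \<le> slow_threshold \<gamma> n" "0 \<le> b" for n
      using a0 \<eta> by (auto simp: \<gamma>_def b_def slow_threshold_def)
    show ?thesis
    proof (rule LIMSEQ_I)
      fix e :: real assume e: "0 < e"
      \<comment> \<open>The radius \<open>R\<close> is fixed before \<open>n\<close> grows: it makes the probability that an endpoint has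
        no finite line nearby small, uniformly in \<open>n\<close>.\<close>
      have "(\<lambda>R. (1 - q) ^ R) \<longlonglongrightarrow> 0"
        using fin N.prob_le_1 by (intro LIMSEQ_realpow_zero) (auto simp: q_def)
      then have "\<forall>\<^sub>F R in sequentially. (1 - q) ^ R < e / 4"
        using e by (intro order_tendstoD(2)[where y = 0]) auto
      then obtain R where R: "(1 - q) ^ R < e / 4"
        by (auto simp: eventually_sequentially)
      define C where "C = real (card (cube (int R) :: (int ^ 'd) set)) * real CARD('d)"
      define h where
        "h = (\<lambda>n. measure N {v \<in> space N. X v \<in> {ennreal (slow_threshold \<gamma> n)<..<\<infinity>}})"
      define g where
        "g = (\<lambda>n. (real (nat (2 * (int n * l1_norm x + int R + 3 * int (window n)) + 1)) ^ CARD('d)) ^ 2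
          * real CARD('d) ^ 2 * (1 - p ^ 2) ^ window n)"
      have "\<gamma> * L < s + \<epsilon>"
        using \<eta> by (simp add: \<gamma>_def s_def distrib_right)
      from order_tendstoD(2)[OF upper_bound_rate[OF \<gamma>0(1)] this]
      have upper: "\<forall>\<^sub>F n in sequentially. (slow_threshold \<gamma> n * (4 * real (window n))
          + \<gamma> * (real n * L + 2 * real R + 4 * real (window n) + 2 * real (window n) * real CARD('d)))
          / real n < s + \<epsilon>" .
      have "s - \<epsilon> < (a - \<eta>) * L"
        using \<eta> by (simp add: s_def left_diff_distrib)
      also have "\<dots> \<le> b * L"
        using L0 by (intro mult_right_mono) (auto simp: b_def)
      finally have "s - \<epsilon> < b * L" .
      from order_tendstoD(1)[OF lower_bound_rate this]
      have lower: "\<forall>\<^sub>F n in sequentially. s - \<epsilon> < b * (real n * L - 2 * real R) / real n" .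
      have bound: "\<forall>\<^sub>F n in sequentially. prob (dev \<epsilon> n) \<le> g n + 2 * (1 - q) ^ R + 2 * (C * h n)"
        using upper lower eventually_gt_at_top[of 0]
      proof eventually_elim
        case (elim n)
        show ?case
          unfolding dev_def T_def g_def q_def C_def h_def p_def
          using elim unfolding L_def
          by (intro prob_deviation_le[OF dim star_closest \<gamma>0 below]) auto
      qed
      have "g \<longlonglongrightarrow> 0"
        unfolding g_def by (intro not_well_connected_bound_tendsto_0 l1_norm_nonneg p)
      moreover have "h \<longlonglongrightarrow> 0"
        unfolding h_def by (rule N.measure_finite_tail_tendsto_0[OF X slow_threshold_at_top])
      ultimately have "(\<lambda>n. g n + 2 * (1 - q) ^ R + 2 * (C * h n))
          \<longlonglongrightarrow> 0 + 2 * (1 - q) ^ R + 2 * (C * 0)"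
        by (intro tendsto_intros)
      then have "\<forall>\<^sub>F n in sequentially. g n + 2 * (1 - q) ^ R + 2 * (C * h n) < e"
        by (rule order_tendstoD(2)) (use R e in simp)
      with bound have "\<forall>\<^sub>F n in sequentially. prob (dev \<epsilon> n) < e"
        by eventually_elim linarith
      then show "\<exists>n0. \<forall>n\<ge>n0. norm (prob (dev \<epsilon> n) - 0) < e"
        by (simp add: eventually_sequentially)
    qed
  qed
  moreover have "(\<lambda>\<omega>. enn2ereal (T n \<omega> / of_nat n)) \<in> borel_measurable M" for n
    by measurable
  ultimately show ?thesis
    unfolding tendsto_in_probability_def dev_def T_def s_def a_def L_def by blast
qed

end
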